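(* Let $(d_k)_{k\ge1}$ and $(N_k)_{k\ge1}$ be sequences of natural numbers such that $(d_k)$ is lacunary, $N_k\mid N_{k+1}$ and $N_k<N_{k+1}$ for all $k$. Then the following conditions are equivalent: (i) there exist constants $a,C$ such that $d_k\le CN_{k+a}$ for all $k$; (ii) there is a constant $c>0$ such that for every $n$ and all trigonometric polynomials $f_1,\dots,f_n\in H^1(\mathbb{T})$ with $\deg f_k\le d_k$, \[\mathbb{E}\Big(\sum_{k=1}^n|f_k|^2\Big)^{1/2}\ge c\,\mathbb{E}\Big(\sum_{k=1}^n|\mathbb{E}^*_{N_k}f_k|^2\Big)^{1/2};\] (iii) there is a constant $c>0$ such that for every $n$ and all trigonometric polynomials $f_1,\dots,f_n\in H^1(\mathbb{T})$ with $\deg f_k\le d_k$, \[\big\|(f_k)_{k=1}^n\big\|_{L^1(\ell^2)}\ge c\,\big\|(\mathbb{E}^*_{N_k}f_k)_{k=1}^n\big\|_{\mathrm{ind}}.\]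
   Context: $\mathbb{T}=\mathbb{R}/2\pi\mathbb{Z}$ with normalized Lebesgue measure $\mu$, and $\mathbb{E}$ denotes integration against $\mu$. $H^1(\mathbb{T})$ is the closed span in $L^1(\mathbb{T})$ of $e^{ijt}$, $j\ge0$. A sequence $(d_k)$ of positive integers is lacunary if $\inf_k d_{k+1}/d_k>1$. For a positive integer $N$, $\mathcal{F}^*_N$ is the $\sigma$-algebra of subsets of $\mathbb{T}$ whose indicator functions are $\frac{2\pi}{N}$-periodic, and $\mathbb{E}^*_N f(t)=\frac1N\sum_{j=0}^{N-1}f(t+\frac{2\pi j}{N})$ is the conditional expectation onto it. For functions $g_1,\dots,g_n$ on $\mathbb{T}$: $\|(g_k)\|_{L^1(\ell^2)}=\mathbb{E}(\sum_k|g_k|^2)^{1/2}$ and $\|(g_k)\|_{\mathrm{ind}}=\int_{\mathbb{T}^n}(\sum_k|g_k(t_k)|^2)^{1/2}\,d\mu(t_1)\cdots d\mu(t_n)$. *)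

theory Defs
  imports "HOL-Probability.Probability"
begin

definition torus :: "real measure" where
  "torus = uniform_measure lborel {0..2*pi}"

definition torus_expect :: "(real \<Rightarrow> real) \<Rightarrow> real" where
  "torus_expect g = integral\<^sup>L torus g"

definition analytic_trig_poly :: "nat \<Rightarrow> (real \<Rightarrow> complex) \<Rightarrow> bool" where
  "analytic_trig_poly d f \<longleftrightarrow>
     (\<exists>a :: nat \<Rightarrow> complex. f = (\<lambda>t. \<Sum>j\<le>d. a j * exp (\<i> * of_nat j * of_real t)))"

text \<open>Conditional expectation onto the sigma-algebra of 2pi/N-periodic sets.\<close>
definition cond_exp_star :: "nat \<Rightarrow> (real \<Rightarrow> complex) \<Rightarrow> real \<Rightarrow> complex" where
  "cond_exp_star N f t = (1 / of_nat N) * (\<Sum>j<N. f (t + 2 * pi * real j / real N))"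

definition lacunary :: "(nat \<Rightarrow> nat) \<Rightarrow> bool" where
  "lacunary d \<longleftrightarrow> (\<exists>q>1. \<forall>k\<ge>1. real (d (Suc k)) \<ge> q * real (d k))"

definition L1_l2_norm :: "nat \<Rightarrow> (nat \<Rightarrow> real \<Rightarrow> complex) \<Rightarrow> real" where
  "L1_l2_norm n g = torus_expect (\<lambda>t. sqrt (\<Sum>k\<in>{1..n}. (cmod (g k t))\<^sup>2))"

definition ind_norm :: "nat \<Rightarrow> (nat \<Rightarrow> real \<Rightarrow> complex) \<Rightarrow> real" where
  "ind_norm n g = integral\<^sup>L (PiM {1..n} (\<lambda>_. torus))
      (\<lambda>x. sqrt (\<Sum>k\<in>{1..n}. (cmod (g k (x k)))\<^sup>2))"

end

theory Submission
  imports Defs "HOL-Computational_Algebra.Polynomial"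
begin

text \<open>
  \<^emph>\<open>Sufficiency of (i).\<close> After splitting the indices into residue classes one may assume
  \<open>d k \<le> C * N l\<close> for \<open>k < l\<close>. Write \<open>g k\<close> for the periodization of \<open>f k\<close> at \<open>N k\<close> and \<open>A k\<close> for
  the square function of the \<open>f l\<close> with \<open>l \<le> k\<close>. Convexity of the Euclidean norm gives
  \<open>E (A k) \<ge> E (sqrt (B\<^sup>2 + |g k|\<^sup>2))\<close>, where \<open>B\<close> is the periodization of \<open>A (k - 1)\<close>; moreover
  \<open>E B = E (A (k - 1))\<close>, and \<open>B\<close> is bounded pointwise by a constant times \<open>E (A (k - 1))\<close>, because
  the degrees involved are \<open>O(N k)\<close>. As \<open>s \<mapsto> sqrt (s\<^sup>2 + x\<^sup>2) - s\<close> is decreasing, with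
  \<open>R = M * E (A n)\<close> these inequalities telescope to \<open>\<Sum>k. E (sqrt (R\<^sup>2 + |g k|\<^sup>2) - R) \<le> E (A n)\<close>.
  The left side depends only on the law of each single \<open>g k\<close>, and \<open>sqrt (\<Sum>k. x k\<^sup>2)\<close> is at
  most \<open>R + (\<Sum>k. sqrt (R\<^sup>2 + x k\<^sup>2) - R)\<close>, so (ii) and (iii) follow simultaneously.

  \<^emph>\<open>Necessity of (i).\<close> If (i) fails, there are arbitrarily long windows of indices on which all
  \<open>d l\<close> exceed \<open>4 * L\<close>, where \<open>L\<close> is the value of \<open>N\<close> at the end of the window. Let all \<open>f l\<close> with
  \<open>l\<close> in a sparse subset of \<open>b\<close> indices equal the fourth power of the modulus of a Dirichlet sum of
  length \<open>L\<close>, modulated to be analytic. The left sides are then \<open>sqrt b * E |f|\<close>, while the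
  periodizations are so concentrated and at such different scales that \<open>E (sqrt (g k * g l))\<close> decays
  geometrically in \<open>|k - l|\<close>; this makes the right sides at least \<open>b / 2 * E |f|\<close>.
\<close>

section \<open>Integration over the torus\<close>

lemma torus_eq_density: "torus = density lborel (\<lambda>x. ennreal (indicator {0..2*pi} x / (2*pi)))"
  unfolding torus_def uniform_measure_def
  by (intro density_cong) (auto simp: divide_ennreal[symmetric] ennreal_mult' split: split_indicator)

lemma sets_torus [simp, measurable_cong]: "sets torus = sets borel"
  by (simp add: torus_def)

lemma space_torus [simp]: "space torus = UNIV"
  by (simp add: torus_def)

lemma prob_space_torus: "prob_space torus"
  unfolding torus_def by (rule prob_space_uniform_measure) auto

text \<open>The measure is carried by the compact interval from 0 to 2 pi, on which a continuous
  function is bounded. This settles nearly all integrability obligations below.\<close>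

lemma integrable_torus_continuous:
  fixes g :: "real \<Rightarrow> 'a::{banach, second_countable_topology}"
  assumes "continuous_on UNIV g"
  shows "integrable torus g"
proof -
  interpret prob_space torus by (rule prob_space_torus)
  have "compact (g ` {0..2*pi})"
    using assms by (intro compact_continuous_image) (auto intro: continuous_on_subset)
  then obtain B where B: "\<And>x. x \<in> {0..2*pi} \<Longrightarrow> norm (g x) \<le> B"
    by (meson bounded_iff compact_imp_bounded imageI)
  have "AE x in torus. norm (g x) \<le> B"
    unfolding torus_def by (rule AE_uniform_measureI) (use B in auto)
  moreover have "g \<in> borel_measurable torus"
    using assms by (simp add: borel_measurable_continuous_onI measurable_cong_sets[OF sets_torus refl])
  ultimately show ?thesis
    by (rule integrable_const_bound)
qed

lemma integral_torus_eq_integral: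
  fixes g :: "real \<Rightarrow> 'a::euclidean_space"
  assumes "continuous_on UNIV g"
  shows "integral\<^sup>L torus g = (1 / (2*pi)) *\<^sub>R integral {0..2*pi} g"
proof -
  have meas: "g \<in> borel_measurable lborel"
    using assms by (simp add: borel_measurable_continuous_onI)
  have "integral\<^sup>L torus g = (\<integral>x. (indicator {0..2*pi} x / (2*pi)) *\<^sub>R g x \<partial>lborel)"
    unfolding torus_eq_density by (rule integral_density) (use meas in auto)
  also have "\<dots> = (\<integral>x. (1 / (2*pi)) *\<^sub>R (indicator {0..2*pi} x *\<^sub>R g x) \<partial>lborel)"
    by simp
  also have "\<dots> = (1 / (2*pi)) *\<^sub>R (\<integral>x. indicator {0..2*pi} x *\<^sub>R g x \<partial>lborel)"
    by (rule integral_scaleR_right)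
  also have "(\<integral>x. indicator {0..2*pi} x *\<^sub>R g x \<partial>lborel) = integral {0..2*pi} g"
  proof -
    have "set_integrable lborel {0..2*pi} g"
      unfolding set_integrable_def
      by (rule borel_integrable_compact) (use assms in \<open>auto intro: continuous_on_subset\<close>)
    from set_borel_integral_eq_integral(2)[OF this] show ?thesis
      by (simp add: set_lebesgue_integral_def)
  qed
  finally show ?thesis .
qed

text \<open>Rotation invariance: the part of the shifted interval beyond 2 pi is cut off and moved
  back by periodicity. The range of \<open>c\<close> covers the shifts \<open>2 * pi * j / N\<close>
  with \<open>j < N\<close>.\<close>

lemma integral_torus_shift:
  fixes g :: "real \<Rightarrow> 'a::euclidean_space"
  assumes cont: "continuous_on UNIV g" and per: "\<And>t. g (t + 2*pi) = g t" and c: "0 \<le> c" "c \<le> 2*pi"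
  shows "(\<integral>t. g (t + c) \<partial>torus) = integral\<^sup>L torus g"
proof -
  have int: "g integrable_on {a..b}" for a b
    by (rule integrable_continuous_real) (use cont in \<open>auto intro: continuous_on_subset\<close>)
  have "integral {0..2*pi} (\<lambda>t. g (t + c)) = integral {c..2*pi+c} g"
    using integral_shift_real_ivl[of c c "2*pi + c" g] by simp
  also have "\<dots> = integral {c..2*pi} g + integral {2*pi..2*pi+c} g"
    using c int by (intro Henstock_Kurzweil_Integration.integral_combine[symmetric]) auto
  also have "integral {2*pi..2*pi+c} g = integral {0..c} g"
    using integral_shift_real_ivl[of "2*pi" "2*pi" "2*pi + c" g] per by simp
  also have "integral {c..2*pi} g + integral {0..c} g = integral {0..2*pi} g"
    using c int Henstock_Kurzweil_Integration.integral_combine[of 0 c "2*pi" g] by (simp add: add.commute)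
  finally have "integral {0..2*pi} (\<lambda>t. g (t + c)) = integral {0..2*pi} g" .
  moreover have "continuous_on UNIV (\<lambda>t. g (t + c))"
    by (intro continuous_on_compose2[OF cont] continuous_intros) auto
  ultimately show ?thesis
    by (simp add: integral_torus_eq_integral cont)
qed

lemma integral_torus_cis:
  fixes k :: int
  shows "(\<integral>t. cis (real_of_int k * t) \<partial>torus) = (if k = 0 then 1 else 0)"
proof (cases "k = 0")
  case True
  then show ?thesis
    using prob_space.prob_space[OF prob_space_torus] by simp
next
  case False
  \<comment> \<open>Half a period of the character: shifting by \<open>c\<close> changes its sign,
    so the integral equals its own negative. Since \<open>k\<close> is a nonzero integer,
    \<open>c\<close> lies within the range allowed for shifts.\<close>
  define c where "c = pi / \<bar>real_of_int k\<bar>"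
  have k1: "\<bar>real_of_int k\<bar> \<ge> 1" using False by linarith
  have c: "0 \<le> c" "c \<le> 2*pi"
    using k1 by (auto simp: c_def divide_le_eq intro: order_trans[of _ "2*pi*1"])
  have kc: "cis (real_of_int k * c) = -1"
    using False by (cases "k > 0") (auto simp: c_def complex_eq_iff)
  have cont: "continuous_on UNIV (\<lambda>t. cis (real_of_int k * t))"
    by (intro continuous_intros)
  have per: "cis (real_of_int k * (t + 2*pi)) = cis (real_of_int k * t)" for t
  proof -
    have "cis (real_of_int k * (2*pi)) = 1"
      by (metis cis_2pi cis_power_int mult.commute power_int_1_left)
    then show ?thesis by (simp add: distrib_left flip: cis_mult)
  qed
  have "(\<integral>t. cis (real_of_int k * t) \<partial>torus) = (\<integral>t. cis (real_of_int k * (t + c)) \<partial>torus)"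
    using integral_torus_shift[OF cont per c] by simp
  also have "\<dots> = (\<integral>t. cis (real_of_int k * t) * cis (real_of_int k * c) \<partial>torus)"
    by (simp add: distrib_left flip: cis_mult)
  also have "\<dots> = - (\<integral>t. cis (real_of_int k * t) \<partial>torus)"
    by (simp add: kc)
  finally show ?thesis using False by simp
qed

text \<open>The average of \<open>cond_exp_star\<close> for values in any real vector space, so that
  it also applies to real square functions and to pairs in
  \<open>real \<times> complex\<close>.\<close>

definition star_mean :: "nat \<Rightarrow> (real \<Rightarrow> 'a::real_vector) \<Rightarrow> real \<Rightarrow> 'a" where
  "star_mean N h t = (1 / real N) *\<^sub>R (\<Sum>j<N. h (t + 2 * pi * real j / real N))"

lemma cond_exp_star_eq_star_mean: "cond_exp_star N f = star_mean N f"
  by (simp add: fun_eq_iff cond_exp_star_def star_mean_def scaleR_conv_of_real)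

lemma continuous_on_star_mean:
  fixes h :: "real \<Rightarrow> 'a::real_normed_vector"
  assumes "continuous_on UNIV h"
  shows "continuous_on UNIV (star_mean N h)"
  unfolding star_mean_def
  by (intro continuous_intros continuous_on_compose2[OF assms]) auto

lemma integral_star_mean:
  fixes h :: "real \<Rightarrow> 'a::euclidean_space"
  assumes cont: "continuous_on UNIV h" and per: "\<And>t. h (t + 2*pi) = h t" and N: "N > 0"
  shows "integral\<^sup>L torus (star_mean N h) = integral\<^sup>L torus h"
proof -
  have cont': "continuous_on UNIV (\<lambda>t. h (t + c))" for c
    by (intro continuous_on_compose2[OF cont] continuous_intros) auto
  have shift: "(\<integral>t. h (t + 2 * pi * real j / real N) \<partial>torus) = integral\<^sup>L torus h" if "j < N" for j
    by (rule integral_torus_shift[OF cont per]) (use that N in \<open>auto simp: divide_le_eq\<close>)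
  have "integral\<^sup>L torus (star_mean N h)
      = (1 / real N) *\<^sub>R (\<Sum>j<N. \<integral>t. h (t + 2 * pi * real j / real N) \<partial>torus)"
    unfolding star_mean_def integral_scaleR_right
    by (subst Bochner_Integration.integral_sum) (auto intro!: integrable_torus_continuous cont')
  also have "\<dots> = integral\<^sup>L torus h"
    using N by (simp add: shift scaleR_sum_left[symmetric] sum_constant_scaleR)
  finally show ?thesis .
qed

section \<open>Dirichlet sums and a reproducing kernel\<close>

text \<open>A character is multiplied at the shifts by the powers of an \<open>N\<close>-th root of
  unity \<open>z\<close>. If \<open>N\<close> does not divide the frequency, then \<open>z\<close>
  is not 1 and the geometric sum vanishes.\<close>

lemma norm_star_mean_cis_le:
  fixes k :: int
  assumes N: "N > 0"
  shows "norm (star_mean N (\<lambda>t. cis (real_of_int k * t)) t) \<le> (if int N dvd k then 1 else 0)"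
proof (cases "int N dvd k")
  case True
  have "norm (\<Sum>j<N. cis (real_of_int k * (t + 2 * pi * real j / real N))) \<le> (\<Sum>j<N. 1)"
    by (rule sum_norm_le) simp
  then show ?thesis
    using True N by (simp add: star_mean_def divide_simps)
next
  case False
  define z where "z = cis (2 * pi * real_of_int k / real N)"
  have "z ^ N = cis (real N * (2 * pi * real_of_int k / real N))"
    unfolding z_def by (rule Complex.DeMoivre)
  also have "real N * (2 * pi * real_of_int k / real N) = 2 * pi * real_of_int k"
    using N by simp
  also have "cis (2 * pi * real_of_int k) = 1"
    using cis_multiple_2pi[of "real_of_int k"] by simp
  finally have zN: "z ^ N = 1" .
  have z1: "z \<noteq> 1"
  proof
    assume "z = 1"
    then have "cos (2 * pi * real_of_int k / real N) = 1"
      by (simp add: z_def complex_eq_iff)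
    then obtain n :: int where "2 * pi * real_of_int k / real N = of_int n * 2 * pi"
      by (auto simp: cos_one_2pi_int)
    then have "real_of_int k = real_of_int n * real N"
      using N by (simp add: field_simps)
    then have "k = n * int N"
      by (metis of_int_eq_iff of_int_mult of_int_of_nat_eq)
    then show False using False by simp
  qed
  have "(\<Sum>j<N. cis (real_of_int k * (t + 2 * pi * real j / real N))) = (\<Sum>j<N. cis (real_of_int k * t) * z ^ j)"
    unfolding z_def Complex.DeMoivre cis_mult by (intro sum.cong refl) (simp add: algebra_simps)
  also have "\<dots> = cis (real_of_int k * t) * (\<Sum>j<N. z ^ j)"
    by (simp add: sum_distrib_left)
  also have "(\<Sum>j<N. z ^ j) = 0"
    using zN z1 by (simp add: geometric_sum)
  finally show ?thesis
    using False by (simp add: star_mean_def)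
qed

definition dirichlet_sum :: "nat \<Rightarrow> real \<Rightarrow> complex" where
  "dirichlet_sum m t = (\<Sum>j<m. cis (real j * t))"

lemma continuous_on_dirichlet_sum [continuous_intros]:
  "continuous_on S f \<Longrightarrow> continuous_on S (\<lambda>x. dirichlet_sum m (f x))"
  unfolding dirichlet_sum_def by (intro continuous_intros)

lemma cis_nat_mult_periodic: "cis (real j * (t + 2*pi)) = cis (real j * t)"
proof -
  have "cis (real j * (2*pi)) = 1"
    using cis_multiple_2pi[of "real j"] by (simp add: mult.commute mult.left_commute)
  then show ?thesis by (simp add: distrib_left flip: cis_mult)
qed

lemma dirichlet_sum_periodic: "dirichlet_sum m (t + 2*pi) = dirichlet_sum m t"
  by (simp add: dirichlet_sum_def cis_nat_mult_periodic)

lemma dirichlet_sum_norm_square: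
  "complex_of_real ((cmod (dirichlet_sum m t))\<^sup>2) =
     (\<Sum>i<m. \<Sum>j<m. cis (real_of_int (int i - int j) * t))"
proof -
  have "complex_of_real ((cmod (dirichlet_sum m t))\<^sup>2) = dirichlet_sum m t * cnj (dirichlet_sum m t)"
    by (rule complex_norm_square)
  then show ?thesis
    by (simp add: dirichlet_sum_def sum_product cis_cnj cis_mult algebra_simps)
qed

text \<open>Numbers in one residue class modulo \<open>N\<close> are told apart by their quotients,
  and the quotients lie between 0 and \<open>m div N\<close>.\<close>

lemma card_congruent_below:
  fixes i :: nat
  assumes "N > 0"
  shows "card {j. j < m \<and> int N dvd int i - int j} \<le> m div N + 1"
proof -
  let ?S = "{j. j < m \<and> int N dvd int i - int j}"
  have "inj_on (\<lambda>j. j div N) ?S"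
  proof (rule inj_onI)
    fix x y assume "x \<in> ?S" "y \<in> ?S" and eq: "x div N = y div N"
    then have "int N dvd (int i - int y) - (int i - int x)"
      by (blast intro: dvd_diff)
    then have "int x mod int N = int y mod int N"
      by (simp add: mod_eq_dvd_iff)
    then have "x mod N = y mod N"
      by (metis of_nat_eq_iff of_nat_mod)
    with eq show "x = y"
      by (metis div_mult_mod_eq)
  qed
  moreover have "(\<lambda>j. j div N) ` ?S \<subseteq> {..m div N}"
    by (auto intro: div_le_mono)
  ultimately have "card ?S \<le> card {..m div N}"
    by (intro card_inj_on_le) auto
  then show ?thesis by simp
qed

text \<open>In the expanded square only pairs of frequencies congruent modulo \<open>N\<close>
  survive the periodization, and each of the \<open>m\<close> frequencies has at most
  \<open>m / N + 1\<close> partners.\<close>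

lemma star_mean_dirichlet_sum_le:
  assumes N: "N > 0"
  shows "star_mean N (\<lambda>t. (cmod (dirichlet_sum m t))\<^sup>2) t \<le> real m * (real m / real N + 1)"
proof -
  let ?e = "\<lambda>i j t. cis (real_of_int (int i - int j) * t)"
  have "complex_of_real (star_mean N (\<lambda>t. (cmod (dirichlet_sum m t))\<^sup>2) t)
      = star_mean N (\<lambda>t. \<Sum>i<m. \<Sum>j<m. ?e i j t) t"
    unfolding star_mean_def by (simp add: scaleR_conv_of_real dirichlet_sum_norm_square del: of_real_power)
  also have "\<dots> = (\<Sum>i<m. \<Sum>j<m. star_mean N (?e i j) t)"
    unfolding star_mean_def scaleR_sum_right
    by (subst sum.swap) (rule sum.cong[OF refl], rule sum.swap)
  finally have "norm (complex_of_real (star_mean N (\<lambda>t. (cmod (dirichlet_sum m t))\<^sup>2) t))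
      \<le> (\<Sum>i<m. \<Sum>j<m. if int N dvd (int i - int j) then 1 else 0)"
    by (simp only:) (intro sum_norm_le norm_star_mean_cis_le[OF N])
  also have "\<dots> \<le> (\<Sum>i<m. real m / real N + 1)"
  proof (rule sum_mono)
    fix i
    have "(\<Sum>j<m. if int N dvd (int i - int j) then 1 else 0)
        = real (card {j. j < m \<and> int N dvd int i - int j})"
      by (subst sum.inter_filter[symmetric]) (auto simp: lessThan_def)
    also have "\<dots> \<le> real (m div N + 1)"
      using card_congruent_below[OF N] by (simp only: of_nat_le_iff)
    also have "\<dots> \<le> real m / real N + 1"
      by (simp add: of_nat_div_le_of_nat)
    finally show "(\<Sum>j<m. if int N dvd (int i - int j) then 1 else 0) \<le> real m / real N + 1" .
  qed
  finally show ?thesis by (simp add: abs_le_iff)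
qed

text \<open>A de la Vallee Poussin type kernel: its Fourier coefficients equal 1 on the frequencies from
  0 to \<open>D\<close>, and as a product of two Dirichlet sums it is dominated by their squares, whose
  periodizations are explicit.\<close>

definition vp_kernel :: "nat \<Rightarrow> real \<Rightarrow> complex" where
  "vp_kernel D t = cnj (dirichlet_sum (D + 1) t) * dirichlet_sum (2 * D + 1) t / of_nat (D + 1)"

lemma continuous_on_vp_kernel [continuous_intros]:
  "continuous_on S f \<Longrightarrow> continuous_on S (\<lambda>x. vp_kernel D (f x))"
  unfolding vp_kernel_def by (intro continuous_intros) (simp_all only: of_nat_eq_0_iff, simp_all)

text \<open>The coefficient at \<open>l\<close> counts pairs \<open>(i, j)\<close> with
  \<open>j - i = l\<close>. For every \<open>i \<le> D\<close> the partner \<open>j = l + i\<close>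
  is at most \<open>2 * D\<close>, so there are exactly \<open>D + 1\<close> pairs, which the
  denominator cancels.\<close>

lemma vp_kernel_reproduces_cis:
  assumes "l \<le> D"
  shows "(\<integral>s. vp_kernel D (t - s) * cis (real l * s) \<partial>torus) = cis (real l * t)"
proof -
  let ?m = "D + 1" and ?p = "2 * D + 1"
  have eq: "vp_kernel D (t - s) * cis (real l * s)
      = (\<Sum>i<?m. \<Sum>j<?p. cis ((real j - real i) * t) * cis (real_of_int (int l - (int j - int i)) * s)) / of_nat ?m" for s
    unfolding vp_kernel_def dirichlet_sum_def cnj_sum sum_product
    unfolding times_divide_eq_left sum_distrib_right
    by (intro arg_cong2[where f = "(/)"] sum.cong refl) (simp add: cis_cnj cis_mult algebra_simps)
  have int: "integrable torus (\<lambda>s. cis ((real j - real i) * t) * cis (real_of_int (int l - (int j - int i)) * s))" for i j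
    by (intro integrable_torus_continuous continuous_intros)
  have "(\<integral>s. vp_kernel D (t - s) * cis (real l * s) \<partial>torus)
      = (\<Sum>i<?m. \<Sum>j<?p. cis ((real j - real i) * t) * (if int l - (int j - int i) = 0 then 1 else 0)) / of_nat ?m"
    unfolding eq integral_divide_zero
    by (subst Bochner_Integration.integral_sum, intro Bochner_Integration.integrable_sum int,
        subst Bochner_Integration.integral_sum, rule int)
       (simp only: integral_mult_right_zero integral_torus_cis)
  also have "\<dots> = (\<Sum>i<?m. cis (real l * t)) / of_nat ?m"
  proof -
    have "(\<Sum>j<?p. cis ((real j - real i) * t) * (if int l - (int j - int i) = 0 then 1 else 0)) = cis (real l * t)"
      if "i < ?m" for i
    proof -
      have "(\<Sum>j<?p. cis ((real j - real i) * t) * (if int l - (int j - int i) = 0 then 1 else 0))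
          = (\<Sum>j<?p. if j = l + i then cis (real l * t) else 0)"
        by (intro sum.cong refl) auto
      also have "\<dots> = cis (real l * t)"
        using that assms by simp
      finally show ?thesis .
    qed
    then show ?thesis by simp
  qed
  also have "\<dots> = cis (real l * t)"
    by (simp del: of_nat_Suc of_nat_add)
  finally show ?thesis .
qed

text \<open>The product of the two Dirichlet sums is at most half the sum of their squares, and each
  square has a bounded periodization. The bound is uniform in \<open>t\<close> and stays O(1) as
  long as \<open>D\<close> is O(\<open>N\<close>).\<close>

lemma star_mean_vp_kernel_le:
  assumes N: "N > 0"
  shows "star_mean N (\<lambda>t. cmod (vp_kernel D t)) t \<le> 5 * (real D + 1) / real N + 3"
proof -
  let ?m = "D + 1" and ?p = "2 * D + 1"
  have *: "cmod (vp_kernel D t) \<le> ((cmod (dirichlet_sum ?m t))\<^sup>2 + (cmod (dirichlet_sum ?p t))\<^sup>2) / (2 * real ?m)" for t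
  proof -
    have "cmod (dirichlet_sum ?m t) * cmod (dirichlet_sum ?p t)
        \<le> ((cmod (dirichlet_sum ?m t))\<^sup>2 + (cmod (dirichlet_sum ?p t))\<^sup>2) / 2"
      using sum_squares_bound[of "cmod (dirichlet_sum ?m t)" "cmod (dirichlet_sum ?p t)"] by simp
    then have "cmod (dirichlet_sum ?m t) * cmod (dirichlet_sum ?p t) / real ?m
        \<le> ((cmod (dirichlet_sum ?m t))\<^sup>2 + (cmod (dirichlet_sum ?p t))\<^sup>2) / 2 / real ?m"
      by (rule divide_right_mono) simp
    then show ?thesis
      unfolding vp_kernel_def norm_divide norm_mult complex_mod_cnj norm_of_nat by simp
  qed
  have "star_mean N (\<lambda>t. cmod (vp_kernel D t)) t
      \<le> star_mean N (\<lambda>t. ((cmod (dirichlet_sum ?m t))\<^sup>2 + (cmod (dirichlet_sum ?p t))\<^sup>2) / (2 * real ?m)) t"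
    unfolding star_mean_def by (intro scaleR_left_mono sum_mono *) auto
  also have "\<dots> = (star_mean N (\<lambda>t. (cmod (dirichlet_sum ?m t))\<^sup>2) t
      + star_mean N (\<lambda>t. (cmod (dirichlet_sum ?p t))\<^sup>2) t) / (2 * real ?m)"
    by (simp add: star_mean_def sum.distrib add_divide_distrib distrib_left sum_divide_distrib sum_distrib_left)
  also have "\<dots> \<le> (real ?m * (real ?m / real N + 1) + real ?p * (real ?p / real N + 1)) / (2 * real ?m)"
    by (intro divide_right_mono add_mono star_mean_dirichlet_sum_le N) simp
  also have "\<dots> \<le> (real ?m * (real ?m / real N + 1) + (2 * real ?m) * ((2 * real ?m) / real N + 1)) / (2 * real ?m)"
    by (intro divide_right_mono add_left_mono mult_mono add_right_mono) auto
  also have "\<dots> = (5 * (real ?m / real N) + 3) / 2"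
  proof -
    have "(x * (x / y + 1) + 2 * x * (2 * x / y + 1)) / (2 * x) = (5 * (x / y) + 3) / 2"
      if "x > 0" "y > 0" for x y :: real
      using that by (simp add: field_simps)
    from this[of "real ?m" "real N"] N show ?thesis by simp
  qed
  also have "\<dots> \<le> 5 * (real ?m / real N) + 3"
  proof -
    have "0 \<le> real ?m / real N" by simp
    then show ?thesis by argo
  qed
  also have "\<dots> = 5 * (real D + 1) / real N + 3"
    by (simp add: add.commute)
  finally show ?thesis .
qed

section \<open>Analytic polynomials and the reproducing formula\<close>

lemma analytic_trig_poly_cis:
  "analytic_trig_poly d f \<longleftrightarrow> (\<exists>a. f = (\<lambda>t. \<Sum>j\<le>d. a j * cis (real j * t)))"
  unfolding analytic_trig_poly_def by (simp add: cis_conv_exp mult.assoc)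

lemma analytic_trig_poly_continuous:
  "analytic_trig_poly d f \<Longrightarrow> continuous_on UNIV f"
  unfolding analytic_trig_poly_cis by (auto intro!: continuous_intros)

lemma analytic_trig_poly_periodic:
  "analytic_trig_poly d f \<Longrightarrow> f (t + 2*pi) = f t"
  unfolding analytic_trig_poly_cis by (auto simp: cis_nat_mult_periodic)

lemma vp_kernel_reproduces:
  assumes f: "analytic_trig_poly d f" and "d \<le> D"
  shows "(\<integral>s. vp_kernel D (t - s) * f s \<partial>torus) = f t"
proof -
  obtain a where f: "f = (\<lambda>t. \<Sum>j\<le>d. a j * cis (real j * t))"
    using f by (auto simp: analytic_trig_poly_cis)
  have "(\<integral>s. vp_kernel D (t - s) * f s \<partial>torus)
      = (\<integral>s. (\<Sum>j\<le>d. a j * (vp_kernel D (t - s) * cis (real j * s))) \<partial>torus)"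
    by (simp add: f sum_distrib_left mult_ac)
  also have "\<dots> = (\<Sum>j\<le>d. \<integral>s. a j * (vp_kernel D (t - s) * cis (real j * s)) \<partial>torus)"
    by (intro Bochner_Integration.integral_sum integrable_torus_continuous continuous_intros)
  also have "\<dots> = (\<Sum>j\<le>d. a j * cis (real j * t))"
    using \<open>d \<le> D\<close> by (intro sum.cong refl) (simp add: vp_kernel_reproduces_cis)
  finally show ?thesis by (simp add: f)
qed

section \<open>The upper bound\<close>

lemma continuous_on_L2_set [continuous_intros]:
  assumes "\<And>k. k \<in> T \<Longrightarrow> continuous_on U (\<lambda>t. f k t)"
  shows "continuous_on U (\<lambda>t. L2_set (\<lambda>k. f k t) T)"
  unfolding L2_set_def using assms by (intro continuous_intros)

lemma continuous_on_L2_set_analytic: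
  assumes "\<And>k. k \<in> T \<Longrightarrow> analytic_trig_poly (d k) (f k)"
  shows "continuous_on UNIV (\<lambda>t. L2_set (\<lambda>k. cmod (f k t)) T)"
  by (intro continuous_intros) (use assms analytic_trig_poly_continuous in blast)

text \<open>Pairing the reproducing formula for the vector of all \<open>f k\<close> with its value
  at \<open>t\<close> and applying Cauchy-Schwarz gives \<open>A(t)^2\<close> on the left and
  \<open>A(t)\<close> times the claimed integral on the right. One divides by \<open>A(t)\<close>,
  so a zero value is treated apart. No constant depends on the size of \<open>T\<close>.\<close>

lemma L2_set_le_vp_kernel:
  assumes f: "\<And>k. k \<in> T \<Longrightarrow> analytic_trig_poly (d k) (f k)" and d: "\<And>k. k \<in> T \<Longrightarrow> d k \<le> D"
  shows "L2_set (\<lambda>k. cmod (f k t)) T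
      \<le> (\<integral>s. cmod (vp_kernel D (t - s)) * L2_set (\<lambda>k. cmod (f k s)) T \<partial>torus)"
proof (cases "L2_set (\<lambda>k. cmod (f k t)) T = 0")
  case True
  then show ?thesis by (auto intro!: integral_nonneg_AE)
next
  case False
  define A where "A = (\<lambda>t. L2_set (\<lambda>k. cmod (f k t)) T)"
  have pos: "A t > 0"
    using False by (simp add: A_def order.not_eq_order_implies_strict)
  have cf: "continuous_on UNIV (f k)" if "k \<in> T" for k
    using f[OF that] by (rule analytic_trig_poly_continuous)
  have cA: "continuous_on UNIV A"
    unfolding A_def by (intro continuous_intros cf)
  have cV: "continuous_on UNIV (\<lambda>s. vp_kernel D (t - s))"
    by (intro continuous_intros)
  have "complex_of_real ((A t)\<^sup>2) = (\<Sum>k\<in>T. complex_of_real ((cmod (f k t))\<^sup>2))"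
    by (simp add: A_def L2_set_def sum_nonneg flip: of_real_power)
  also have "\<dots> = (\<Sum>k\<in>T. cnj (f k t) * f k t)"
    by (simp only: complex_norm_square mult.commute)
  also have "\<dots> = (\<Sum>k\<in>T. cnj (f k t) * (\<integral>s. vp_kernel D (t - s) * f k s \<partial>torus))"
    using vp_kernel_reproduces[OF f d] by simp
  also have "\<dots> = (\<Sum>k\<in>T. \<integral>s. cnj (f k t) * (vp_kernel D (t - s) * f k s) \<partial>torus)"
    by simp
  also have "\<dots> = (\<integral>s. (\<Sum>k\<in>T. cnj (f k t) * (vp_kernel D (t - s) * f k s)) \<partial>torus)"
    by (intro Bochner_Integration.integral_sum[symmetric] integrable_torus_continuous continuous_intros cf)
  finally have "(A t)\<^sup>2 = norm (\<integral>s. (\<Sum>k\<in>T. cnj (f k t) * (vp_kernel D (t - s) * f k s)) \<partial>torus)"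
    by (metis abs_of_nonneg norm_of_real zero_le_power2)
  also have "\<dots> \<le> (\<integral>s. norm (\<Sum>k\<in>T. cnj (f k t) * (vp_kernel D (t - s) * f k s)) \<partial>torus)"
    by (rule integral_norm_bound)
  also have "\<dots> \<le> (\<integral>s. A t * (cmod (vp_kernel D (t - s)) * A s) \<partial>torus)"
  proof (intro integral_mono integrable_torus_continuous continuous_intros cf cA)
    fix s
    have "norm (\<Sum>k\<in>T. cnj (f k t) * (vp_kernel D (t - s) * f k s))
        \<le> (\<Sum>k\<in>T. cmod (vp_kernel D (t - s)) * (cmod (f k t) * cmod (f k s)))"
      by (rule sum_norm_le) (simp add: norm_mult)
    also have "\<dots> = cmod (vp_kernel D (t - s)) * (\<Sum>k\<in>T. \<bar>cmod (f k t)\<bar> * \<bar>cmod (f k s)\<bar>)"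
      by (simp add: sum_distrib_left)
    also have "\<dots> \<le> cmod (vp_kernel D (t - s)) * (A t * A s)"
      unfolding A_def by (intro mult_left_mono L2_set_mult_ineq) simp
    finally show "norm (\<Sum>k\<in>T. cnj (f k t) * (vp_kernel D (t - s) * f k s))
        \<le> A t * (cmod (vp_kernel D (t - s)) * A s)"
      by (simp add: mult_ac)
  qed
  also have "\<dots> = A t * (\<integral>s. cmod (vp_kernel D (t - s)) * A s \<partial>torus)"
    by simp
  finally have "A t * A t \<le> A t * (\<integral>s. cmod (vp_kernel D (t - s)) * A s \<partial>torus)"
    by (simp add: power2_eq_square)
  with pos show ?thesis
    by (simp add: A_def)
qed

text \<open>Periodizing the kernel estimate in \<open>t\<close> moves the average onto the modulus
  of the kernel, whose periodization is bounded when the degrees are O(\<open>N\<close>).\<close>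

lemma star_mean_L2_set_le:
  assumes f: "\<And>k. k \<in> T \<Longrightarrow> analytic_trig_poly (d k) (f k)"
    and d: "\<And>k. k \<in> T \<Longrightarrow> real (d k) \<le> C * real N" and C: "C \<ge> 0" and N: "N > 0"
  shows "star_mean N (\<lambda>t. L2_set (\<lambda>k. cmod (f k t)) T) t
      \<le> (5 * C + 8) * (\<integral>t. L2_set (\<lambda>k. cmod (f k t)) T \<partial>torus)"
proof -
  define A where "A = (\<lambda>t. L2_set (\<lambda>k. cmod (f k t)) T)"
  \<comment> \<open>The largest integer below \<open>C * N\<close>: it dominates every degree
    \<open>d k\<close>, and \<open>N \<ge> 1\<close> turns the kernel bound
    \<open>5 * (D + 1) / N + 3\<close> into \<open>5 * C + 8\<close>.\<close>
  define D where "D = nat \<lfloor>C * real N\<rfloor>"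
  have dD: "d k \<le> D" if "k \<in> T" for k
    using d[OF that] unfolding D_def by (simp add: le_nat_floor)
  have DC: "real D \<le> C * real N"
    unfolding D_def using C by (simp add: of_nat_floor)
  have cA: "continuous_on UNIV A"
    unfolding A_def by (rule continuous_on_L2_set_analytic[OF f])
  have A0: "A s \<ge> 0" for s
    by (simp add: A_def)
  have "star_mean N A t \<le> (1 / real N) *\<^sub>R
      (\<Sum>j<N. \<integral>s. cmod (vp_kernel D (t + 2 * pi * real j / real N - s)) * A s \<partial>torus)"
    unfolding star_mean_def A_def
    by (intro scaleR_left_mono sum_mono L2_set_le_vp_kernel[where d = d] f dD) auto
  also have "\<dots> = (\<integral>s. (1 / real N) *\<^sub>R
      (\<Sum>j<N. cmod (vp_kernel D (t + 2 * pi * real j / real N - s)) * A s) \<partial>torus)"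
    unfolding integral_scaleR_right
    by (subst Bochner_Integration.integral_sum)
       (auto intro!: integrable_torus_continuous continuous_intros cA)
  also have "\<dots> = (\<integral>s. star_mean N (\<lambda>x. cmod (vp_kernel D x)) (t - s) * A s \<partial>torus)"
    unfolding star_mean_def by (simp add: sum_distrib_left sum_distrib_right algebra_simps)
  also have "\<dots> \<le> (\<integral>s. (5 * C + 8) * A s \<partial>torus)"
  proof (intro integral_mono integrable_torus_continuous continuous_intros cA)
    show "continuous_on UNIV (\<lambda>s. star_mean N (\<lambda>x. cmod (vp_kernel D x)) (t - s))"
      unfolding star_mean_def by (intro continuous_intros)
    fix s
    have "star_mean N (\<lambda>x. cmod (vp_kernel D x)) (t - s) \<le> 5 * (real D + 1) / real N + 3"
      by (rule star_mean_vp_kernel_le[OF N])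
    also have "\<dots> \<le> 5 * C + 8"
    proof -
      have "5 * (real D + 1) \<le> (5 + 5 * C) * real N"
        using DC N by (simp add: algebra_simps)
      then show ?thesis using N by (simp add: divide_le_eq)
    qed
    finally show "star_mean N (\<lambda>x. cmod (vp_kernel D x)) (t - s) * A s \<le> (5 * C + 8) * A s"
      by (rule mult_right_mono) (rule A0)
  qed
  finally show ?thesis by (simp add: A_def)
qed

section \<open>Increments of the square function\<close>

text \<open>Triangle inequality for the average of the vectors \<open>(A, f)\<close> in the
  Euclidean norm of \<open>real \<times> complex\<close>.\<close>

lemma sqrt_star_mean_le:
  fixes A :: "real \<Rightarrow> real" and f :: "real \<Rightarrow> complex"
  shows "sqrt ((star_mean N A t)\<^sup>2 + (cmod (star_mean N f t))\<^sup>2)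
      \<le> star_mean N (\<lambda>t. sqrt ((A t)\<^sup>2 + (cmod (f t))\<^sup>2)) t"
proof -
  have "sqrt ((star_mean N A t)\<^sup>2 + (cmod (star_mean N f t))\<^sup>2) = norm (star_mean N (\<lambda>t. (A t, f t)) t)"
    by (simp add: star_mean_def sum_prod norm_Pair power_divide)
  also have "\<dots> \<le> (1 / real N) * (\<Sum>j<N. norm (A (t + 2 * pi * real j / real N), f (t + 2 * pi * real j / real N)))"
    unfolding star_mean_def norm_scaleR by (intro mult_mono norm_sum) auto
  also have "\<dots> = star_mean N (\<lambda>t. sqrt ((A t)\<^sup>2 + (cmod (f t))\<^sup>2)) t"
    by (simp add: star_mean_def norm_Pair)
  finally show ?thesis .
qed

text \<open>Triangle inequality for \<open>(r, x) = (s, x) + (r - s, 0)\<close>.\<close>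

lemma sqrt_sum_squares_diff_antimono:
  fixes r s x :: real
  assumes "s \<le> r"
  shows "sqrt (r\<^sup>2 + x\<^sup>2) - r \<le> sqrt (s\<^sup>2 + x\<^sup>2) - s"
  using real_sqrt_sum_squares_triangle_ineq[of s "r - s" x 0] assms by simp

text \<open>Coordinates are added one at a time. The norm reached so far is at least
  \<open>R\<close>, so the next coordinate raises it by no more than it would raise
  \<open>R\<close>.\<close>

lemma sqrt_sum_squares_telescope:
  fixes R :: real
  assumes "finite S" and R: "R \<ge> 0"
  shows "sqrt (R\<^sup>2 + (\<Sum>k\<in>S. (x k)\<^sup>2)) \<le> R + (\<Sum>k\<in>S. sqrt (R\<^sup>2 + (x k)\<^sup>2) - R)"
  using \<open>finite S\<close>
proof induction
  case empty
  then show ?case using R by simp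
next
  case (insert k S)
  let ?s = "sqrt (R\<^sup>2 + (\<Sum>k\<in>S. (x k)\<^sup>2))"
  have nn: "0 \<le> (\<Sum>k\<in>S. (x k)\<^sup>2)"
    by (simp add: sum_nonneg)
  have "R \<le> ?s"
    using nn by (intro real_le_rsqrt) simp
  then have "sqrt (?s\<^sup>2 + (x k)\<^sup>2) - ?s \<le> sqrt (R\<^sup>2 + (x k)\<^sup>2) - R"
    by (rule sqrt_sum_squares_diff_antimono)
  moreover have "?s\<^sup>2 + (x k)\<^sup>2 = R\<^sup>2 + (\<Sum>k\<in>insert k S. (x k)\<^sup>2)"
    using insert nn by simp
  ultimately show ?case
    using insert by simp
qed

text \<open>Induction that adds the largest index last: the term of the new index is paid for by the
  growth of the mean of the square function.\<close>

lemma sum_integral_increments_le: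
  fixes d N :: "nat \<Rightarrow> nat"
  assumes "finite S" and f: "\<And>k. k \<in> S \<Longrightarrow> analytic_trig_poly (d k) (f k)"
    and N: "\<And>k. k \<in> S \<Longrightarrow> N k > 0" and C: "C \<ge> 0"
    and d: "\<And>k l. k \<in> S \<Longrightarrow> l \<in> S \<Longrightarrow> k < l \<Longrightarrow> real (d k) \<le> C * real (N l)"
    and R: "(5 * C + 8) * (\<integral>t. L2_set (\<lambda>k. cmod (f k t)) S \<partial>torus) \<le> R"
  shows "(\<Sum>k\<in>S. \<integral>t. sqrt (R\<^sup>2 + (cmod (star_mean (N k) (f k) t))\<^sup>2) - R \<partial>torus)
      \<le> (\<integral>t. L2_set (\<lambda>k. cmod (f k t)) S \<partial>torus)"
  using assms
proof (induction S rule: finite_linorder_max_induct)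
  case empty
  then show ?case by simp
next
  case (insert b S)
  define A where "A = (\<lambda>t. L2_set (\<lambda>k. cmod (f k t)) S)"
  define B where "B = star_mean (N b) A"
  define g where "g = star_mean (N b) (f b)"
  define A' where "A' = (\<lambda>t. L2_set (\<lambda>k. cmod (f k t)) (insert b S))"
  have A'_eq: "A' t = sqrt ((A t)\<^sup>2 + (cmod (f b t))\<^sup>2)" for t
    using insert.hyps by (auto simp: A'_def A_def L2_set_def sum_nonneg add.commute)
  have cf: "continuous_on UNIV (f k)" if "k \<in> insert b S" for k
    using insert.prems(1)[OF that] by (rule analytic_trig_poly_continuous)
  have cA: "continuous_on UNIV A" and cA': "continuous_on UNIV A'"
    unfolding A_def A'_def by (intro continuous_intros cf; simp)+
  have cB: "continuous_on UNIV B" and cg: "continuous_on UNIV g"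
    unfolding B_def g_def by (intro continuous_on_star_mean cA cf; simp)+
  have perf: "f k (t + 2*pi) = f k t" if "k \<in> insert b S" for k t
    using insert.prems(1)[OF that] by (rule analytic_trig_poly_periodic)
  have perA: "A (t + 2*pi) = A t" and perA': "A' (t + 2*pi) = A' t" for t
    unfolding A_def A'_def L2_set_def by (simp_all add: perf)
  have Nb: "N b > 0" using insert.prems(2) by simp
  have intAA': "integral\<^sup>L torus A \<le> integral\<^sup>L torus A'"
    by (intro integral_mono integrable_torus_continuous cA cA')
       (auto simp: A'_eq intro: real_le_rsqrt)
  \<comment> \<open>\<open>R\<close> is the same for all stages of the induction; its lower bound
    passes to the smaller set because the square function only grows with the set.\<close>
  have R': "(5 * C + 8) * integral\<^sup>L torus A \<le> R"
  proof -
    have "(5 * C + 8) * integral\<^sup>L torus A \<le> (5 * C + 8) * integral\<^sup>L torus A'"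
      using C by (intro mult_left_mono intAA') simp
    also have "\<dots> \<le> R" using insert.prems(5) by (simp add: A'_def)
    finally show ?thesis .
  qed
  \<comment> \<open>All indices of \<open>S\<close> lie below \<open>b\<close>, so their degrees are
    at most \<open>C * N b\<close> and the periodized square function is controlled by its
    mean.\<close>
  have BR: "B t \<le> R" for t
  proof -
    have "B t \<le> (5 * C + 8) * integral\<^sup>L torus A"
      unfolding B_def A_def
      by (rule star_mean_L2_set_le[where d = d]) (use insert.prems insert.hyps Nb in auto)
    then show ?thesis using R' by simp
  qed
  have IH: "(\<Sum>k\<in>S. \<integral>t. sqrt (R\<^sup>2 + (cmod (star_mean (N k) (f k) t))\<^sup>2) - R \<partial>torus) \<le> integral\<^sup>L torus A"
    unfolding A_def by (rule insert.IH) (use insert.prems R' in \<open>auto simp: A_def\<close>)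
  \<comment> \<open>Lowering \<open>R\<close> to \<open>B\<close> enlarges the increment, convexity
    bounds the result by the periodization of \<open>A'\<close>, and periodization preserves
    means.\<close>
  have "(\<integral>t. sqrt (R\<^sup>2 + (cmod (g t))\<^sup>2) - R \<partial>torus) \<le> (\<integral>t. sqrt ((B t)\<^sup>2 + (cmod (g t))\<^sup>2) - B t \<partial>torus)"
    by (intro integral_mono integrable_torus_continuous continuous_intros cB cg
        sqrt_sum_squares_diff_antimono BR)
  also have "\<dots> \<le> (\<integral>t. star_mean (N b) A' t - B t \<partial>torus)"
    unfolding A'_eq B_def g_def
    by (intro integral_mono integrable_torus_continuous continuous_intros continuous_on_star_mean
        cB[unfolded B_def] cg[unfolded g_def] diff_right_mono sqrt_star_mean_le cA cf) auto
  also have "\<dots> = integral\<^sup>L torus (star_mean (N b) A') - integral\<^sup>L torus B"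
    by (intro Bochner_Integration.integral_diff integrable_torus_continuous continuous_on_star_mean cA' cB)
  also have "\<dots> = integral\<^sup>L torus A' - integral\<^sup>L torus A"
    unfolding B_def by (simp add: integral_star_mean cA cA' perA perA' Nb)
  finally have "(\<integral>t. sqrt (R\<^sup>2 + (cmod (g t))\<^sup>2) - R \<partial>torus) \<le> integral\<^sup>L torus A' - integral\<^sup>L torus A" .
  moreover have "b \<notin> S" using insert.hyps by auto
  ultimately show ?case
    using IH insert.hyps by (simp add: A'_def g_def)
qed

text \<open>Uniform variables with an arbitrary joint law: identical ones give the norms of (ii),
  independent ones those of (iii).\<close>

locale torus_coupling = prob_space W for W :: "'w measure" +
  fixes I :: "nat set" and X :: "nat \<Rightarrow> 'w \<Rightarrow> real"
  assumes measurable_X [measurable]: "k \<in> I \<Longrightarrow> X k \<in> borel_measurable W"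
    and distr_X: "k \<in> I \<Longrightarrow> distr W torus (X k) = torus"
begin

lemma measurable_X_torus: "k \<in> I \<Longrightarrow> X k \<in> measurable W torus"
  using measurable_X by (simp add: measurable_cong_sets[OF refl sets_torus])

lemma measurable_coupling:
  fixes \<phi> :: "real \<Rightarrow> 'a::topological_space"
  assumes "k \<in> I" and "continuous_on UNIV \<phi>"
  shows "(\<lambda>w. \<phi> (X k w)) \<in> borel_measurable W"
  using measurable_X[OF assms(1)] borel_measurable_continuous_onI[OF assms(2)]
  by (rule measurable_compose)

lemma integrable_coupling:
  fixes \<phi> :: "real \<Rightarrow> 'a::{banach, second_countable_topology}"
  assumes "k \<in> I" and "continuous_on UNIV \<phi>"
  shows "integrable W (\<lambda>w. \<phi> (X k w))"
proof -
  have "integrable (distr W torus (X k)) \<phi>"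
    using integrable_torus_continuous[OF assms(2)] distr_X[OF assms(1)] by simp
  then show ?thesis
    by (rule integrable_distr[OF measurable_X_torus[OF assms(1)]])
qed

text \<open>Change of variables: a function of a single \<open>X k\<close> has the same mean under
  every coupling.\<close>

lemma integral_coupling:
  fixes \<phi> :: "real \<Rightarrow> 'a::{banach, second_countable_topology}"
  assumes "k \<in> I" and "continuous_on UNIV \<phi>"
  shows "(\<integral>w. \<phi> (X k w) \<partial>W) = integral\<^sup>L torus \<phi>"
proof -
  have "integral\<^sup>L (distr W torus (X k)) \<phi> = (\<integral>w. \<phi> (X k w) \<partial>W)"
    by (rule integral_distr[OF measurable_X_torus[OF assms(1)]])
       (use assms(2) in \<open>simp add: borel_measurable_continuous_onI measurable_cong_sets[OF sets_torus refl]\<close>)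
  then show ?thesis using distr_X[OF assms(1)] by simp
qed

lemma integrable_L2_set_coupling:
  fixes g :: "nat \<Rightarrow> real \<Rightarrow> complex"
  assumes "S \<subseteq> I" and g: "\<And>k. k \<in> S \<Longrightarrow> continuous_on UNIV (g k)"
  shows "integrable W (\<lambda>w. L2_set (\<lambda>k. cmod (g k (X k w))) S)"
proof (rule Bochner_Integration.integrable_bound)
  show "integrable W (\<lambda>w. \<Sum>k\<in>S. cmod (g k (X k w)))"
    using assms by (intro Bochner_Integration.integrable_sum integrable_coupling[where \<phi> = "\<lambda>t. cmod (g _ t)"]
        continuous_intros) auto
  have [measurable]: "(\<lambda>w. g k (X k w)) \<in> borel_measurable W" if "k \<in> S" for k
    using that assms by (intro measurable_coupling) auto
  show "(\<lambda>w. L2_set (\<lambda>k. cmod (g k (X k w))) S) \<in> borel_measurable W"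
    unfolding L2_set_def by measurable
qed (auto simp: L2_set_le_sum abs_of_nonneg sum_nonneg)

text \<open>After \<open>R\<close> is inserted under the root, the telescoping bound leaves a sum of
  terms each depending on one \<open>X k\<close>, so the joint law drops out. The constant is that
  of \<open>R\<close> plus one for the sum of increments.\<close>

lemma integral_L2_set_star_mean_le:
  fixes d N :: "nat \<Rightarrow> nat"
  assumes S: "finite S" "S \<subseteq> I" and f: "\<And>k. k \<in> S \<Longrightarrow> analytic_trig_poly (d k) (f k)"
    and N: "\<And>k. k \<in> S \<Longrightarrow> N k > 0" and C: "C \<ge> 0"
    and d: "\<And>k l. k \<in> S \<Longrightarrow> l \<in> S \<Longrightarrow> k < l \<Longrightarrow> real (d k) \<le> C * real (N l)"
  shows "(\<integral>w. L2_set (\<lambda>k. cmod (star_mean (N k) (f k) (X k w))) S \<partial>W)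
      \<le> (5 * C + 9) * (\<integral>t. L2_set (\<lambda>k. cmod (f k t)) S \<partial>torus)"
proof -
  define \<Phi> where "\<Phi> = (\<integral>t. L2_set (\<lambda>k. cmod (f k t)) S \<partial>torus)"
  define R where "R = (5 * C + 8) * \<Phi>"
  define g where "g k = star_mean (N k) (f k)" for k
  have \<Phi>0: "\<Phi> \<ge> 0"
    unfolding \<Phi>_def by (auto intro!: integral_nonneg_AE)
  have R0: "R \<ge> 0"
    using C \<Phi>0 by (simp add: R_def)
  have cg: "continuous_on UNIV (g k)" if "k \<in> S" for k
    unfolding g_def using f[OF that] by (intro continuous_on_star_mean analytic_trig_poly_continuous)
  have ch: "continuous_on UNIV (\<lambda>t. sqrt (R\<^sup>2 + (cmod (g k t))\<^sup>2) - R)" if "k \<in> S" for k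
    by (intro continuous_intros cg that)
  have ih: "integrable W (\<lambda>w. sqrt (R\<^sup>2 + (cmod (g k (X k w)))\<^sup>2) - R)" if "k \<in> S" for k
    using that S by (intro integrable_coupling[where \<phi> = "\<lambda>t. sqrt (R\<^sup>2 + (cmod (g k t))\<^sup>2) - R"] ch) auto
  have "(\<integral>w. L2_set (\<lambda>k. cmod (g k (X k w))) S \<partial>W)
      \<le> (\<integral>w. R + (\<Sum>k\<in>S. sqrt (R\<^sup>2 + (cmod (g k (X k w)))\<^sup>2) - R) \<partial>W)"
  proof (rule integral_mono)
    show "integrable W (\<lambda>w. L2_set (\<lambda>k. cmod (g k (X k w))) S)"
      using S cg by (intro integrable_L2_set_coupling)
    show "integrable W (\<lambda>w. R + (\<Sum>k\<in>S. sqrt (R\<^sup>2 + (cmod (g k (X k w)))\<^sup>2) - R))"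
      using ih by (intro Bochner_Integration.integrable_add Bochner_Integration.integrable_sum) auto
    fix w
    have "L2_set (\<lambda>k. cmod (g k (X k w))) S \<le> sqrt (R\<^sup>2 + (\<Sum>k\<in>S. (cmod (g k (X k w)))\<^sup>2))"
      unfolding L2_set_def by (intro real_sqrt_le_mono) simp
    also have "\<dots> \<le> R + (\<Sum>k\<in>S. sqrt (R\<^sup>2 + (cmod (g k (X k w)))\<^sup>2) - R)"
      by (rule sqrt_sum_squares_telescope[OF S(1) R0])
    finally show "L2_set (\<lambda>k. cmod (g k (X k w))) S \<le> R + (\<Sum>k\<in>S. sqrt (R\<^sup>2 + (cmod (g k (X k w)))\<^sup>2) - R)" .
  qed
  also have "\<dots> = R + (\<Sum>k\<in>S. \<integral>w. sqrt (R\<^sup>2 + (cmod (g k (X k w)))\<^sup>2) - R \<partial>W)"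
    using ih by (simp add: prob_space)
  also have "(\<Sum>k\<in>S. \<integral>w. sqrt (R\<^sup>2 + (cmod (g k (X k w)))\<^sup>2) - R \<partial>W)
      = (\<Sum>k\<in>S. \<integral>t. sqrt (R\<^sup>2 + (cmod (g k t))\<^sup>2) - R \<partial>torus)"
    using S ch
    by (intro sum.cong refl integral_coupling[where \<phi> = "\<lambda>t. sqrt (R\<^sup>2 + (cmod (g _ t))\<^sup>2) - R"]) auto
  also have "\<dots> \<le> \<Phi>"
    unfolding \<Phi>_def g_def
    by (rule sum_integral_increments_le[OF S(1) f N C d]) (auto simp: R_def \<Phi>_def)
  finally show ?thesis
    by (simp add: R_def \<Phi>_def g_def algebra_simps)
qed

text \<open>The index set is split into residue classes modulo \<open>a\<close>. Distinct members of
  a class differ by at least \<open>a\<close>, so the previous bound applies to each class; adding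
  up the classes costs the factor \<open>a\<close>.\<close>

lemma integral_L2_set_star_mean_le_step:
  fixes d N :: "nat \<Rightarrow> nat"
  assumes S: "finite S" "S \<subseteq> I" and f: "\<And>k. k \<in> S \<Longrightarrow> analytic_trig_poly (d k) (f k)"
    and N: "\<And>k. k \<in> S \<Longrightarrow> N k > 0" and C: "C \<ge> 0" and a: "a > 0"
    and d: "\<And>k l. k \<in> S \<Longrightarrow> l \<in> S \<Longrightarrow> k + a \<le> l \<Longrightarrow> real (d k) \<le> C * real (N l)"
  shows "(\<integral>w. L2_set (\<lambda>k. cmod (star_mean (N k) (f k) (X k w))) S \<partial>W)
      \<le> real a * (5 * C + 9) * (\<integral>t. L2_set (\<lambda>k. cmod (f k t)) S \<partial>torus)"
proof -
  define g where "g k = star_mean (N k) (f k)" for k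
  define P where "P r = {k \<in> S. k mod a = r}" for r
  have cg: "continuous_on UNIV (g k)" if "k \<in> S" for k
    unfolding g_def using f[OF that] by (intro continuous_on_star_mean analytic_trig_poly_continuous)
  have PS: "P r \<subseteq> S" "finite (P r)" for r
    using S by (auto simp: P_def)
  have split: "L2_set x S \<le> (\<Sum>r<a. L2_set x (P r))" for x :: "nat \<Rightarrow> real"
  proof -
    have "(\<Sum>k\<in>S. (x k)\<^sup>2) = (\<Sum>r<a. \<Sum>k\<in>P r. (x k)\<^sup>2)"
      unfolding P_def using S a by (intro sum.group[symmetric]) auto
    also have "\<dots> = (\<Sum>r<a. (L2_set x (P r))\<^sup>2)"
      by (simp add: L2_set_def sum_nonneg)
    finally have "L2_set x S = L2_set (\<lambda>r. L2_set x (P r)) {..<a}"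
      by (simp add: L2_set_def)
    also have "\<dots> \<le> (\<Sum>r<a. L2_set x (P r))"
      by (rule L2_set_le_sum) simp
    finally show ?thesis .
  qed
  have part: "(\<integral>w. L2_set (\<lambda>k. cmod (g k (X k w))) (P r) \<partial>W)
      \<le> (5 * C + 9) * (\<integral>t. L2_set (\<lambda>k. cmod (f k t)) S \<partial>torus)" for r
  proof -
    have gap: "k + a \<le> l" if "k \<in> P r" "l \<in> P r" "k < l" for k l
    proof -
      have "a dvd l - k"
        using that by (metis (mono_tags, lifting) P_def less_imp_le mem_Collect_eq mod_eq_dvd_iff_nat)
      then have "a \<le> l - k"
        using that by (intro dvd_imp_le) auto
      then show ?thesis using that by simp
    qed
    have "(\<integral>w. L2_set (\<lambda>k. cmod (g k (X k w))) (P r) \<partial>W)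
        \<le> (5 * C + 9) * (\<integral>t. L2_set (\<lambda>k. cmod (f k t)) (P r) \<partial>torus)"
      unfolding g_def
    proof (rule integral_L2_set_star_mean_le)
      show "analytic_trig_poly (d k) (f k)" "0 < N k" if "k \<in> P r" for k
        using that PS f N by blast+
      show "real (d k) \<le> C * real (N l)" if "k \<in> P r" "l \<in> P r" "k < l" for k l
        using that PS gap d by blast
    qed (use PS S C in auto)
    also have "\<dots> \<le> (5 * C + 9) * (\<integral>t. L2_set (\<lambda>k. cmod (f k t)) S \<partial>torus)"
    proof (intro mult_left_mono integral_mono integrable_torus_continuous)
      show "continuous_on UNIV (\<lambda>t. L2_set (\<lambda>k. cmod (f k t)) S)"
        "continuous_on UNIV (\<lambda>t. L2_set (\<lambda>k. cmod (f k t)) (P r))"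
        using f PS by (auto intro!: continuous_on_L2_set_analytic)
      show "L2_set (\<lambda>k. cmod (f k t)) (P r) \<le> L2_set (\<lambda>k. cmod (f k t)) S" for t
        unfolding L2_set_def using PS S by (intro real_sqrt_le_mono sum_mono2) auto
    qed (use C in auto)
    finally show ?thesis .
  qed
  have int: "integrable W (\<lambda>w. L2_set (\<lambda>k. cmod (g k (X k w))) T)" if "T \<subseteq> S" for T
    using that S cg by (intro integrable_L2_set_coupling) auto
  have "(\<integral>w. L2_set (\<lambda>k. cmod (g k (X k w))) S \<partial>W)
      \<le> (\<integral>w. (\<Sum>r<a. L2_set (\<lambda>k. cmod (g k (X k w))) (P r)) \<partial>W)"
    by (intro integral_mono Bochner_Integration.integrable_sum int split PS) simp
  also have "\<dots> = (\<Sum>r<a. \<integral>w. L2_set (\<lambda>k. cmod (g k (X k w))) (P r) \<partial>W)"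
    by (intro Bochner_Integration.integral_sum int PS)
  also have "\<dots> \<le> (\<Sum>r<a. (5 * C + 9) * (\<integral>t. L2_set (\<lambda>k. cmod (f k t)) S \<partial>torus))"
    by (intro sum_mono part)
  finally show ?thesis
    by (simp add: g_def mult.assoc)
qed

end

lemma torus_coupling_identity: "torus_coupling torus I (\<lambda>k t. t)"
proof -
  interpret prob_space torus by (rule prob_space_torus)
  show ?thesis
  proof
    show "distr torus torus (\<lambda>t. t) = torus"
      using distr_id[of torus] by (simp add: id_def)
  qed (simp add: measurable_cong_sets[OF sets_torus refl])
qed

lemma torus_coupling_product: "torus_coupling (PiM I (\<lambda>_. torus)) I (\<lambda>k x. x k)"
proof -
  interpret prob_space "PiM I (\<lambda>_. torus)"
    by (intro prob_space_PiM prob_space_torus)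
  show ?thesis
  proof
    fix k assume k: "k \<in> I"
    then have "(\<lambda>x. x k) \<in> measurable (PiM I (\<lambda>_. torus)) torus"
      by (rule measurable_component_singleton)
    then show "(\<lambda>x. x k) \<in> borel_measurable (PiM I (\<lambda>_. torus))"
      by (simp add: measurable_cong_sets[OF refl sets_torus])
    show "distr (PiM I (\<lambda>_. torus)) torus (\<lambda>x. x k) = torus"
      using distr_PiM_component[of I "\<lambda>_. torus" k] prob_space_torus k by simp
  qed
qed

section \<open>Peaked polynomials\<close>

text \<open>Lets products and degree bounds be handled in the ring of polynomials evaluated at
  \<open>cis t\<close>.\<close>

lemma analytic_trig_poly_iff_poly:
  "analytic_trig_poly d f \<longleftrightarrow> (\<exists>p. degree p \<le> d \<and> f = (\<lambda>t. poly p (cis t)))"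
proof
  assume "analytic_trig_poly d f"
  then obtain a where f: "f = (\<lambda>t. \<Sum>j\<le>d. a j * cis (real j * t))"
    by (auto simp: analytic_trig_poly_cis)
  have "degree (\<Sum>j\<le>d. monom (a j) j) \<le> d"
    by (intro degree_sum_le) (auto intro: order_trans[OF degree_monom_le])
  moreover have "f = (\<lambda>t. poly (\<Sum>j\<le>d. monom (a j) j) (cis t))"
    by (simp add: f poly_sum poly_monom Complex.DeMoivre)
  ultimately show "\<exists>p. degree p \<le> d \<and> f = (\<lambda>t. poly p (cis t))" by blast
next
  assume "\<exists>p. degree p \<le> d \<and> f = (\<lambda>t. poly p (cis t))"
  then obtain p where p: "degree p \<le> d" and f: "f = (\<lambda>t. poly p (cis t))" by blast
  have "poly p x = (\<Sum>j\<le>d. coeff p j * x ^ j)" for x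
    by (subst poly_as_sum_of_monoms'[OF p, symmetric]) (simp add: poly_sum poly_monom)
  then have "f = (\<lambda>t. \<Sum>j\<le>d. coeff p j * cis (real j * t))"
    by (simp add: f Complex.DeMoivre)
  then show "analytic_trig_poly d f"
    by (auto simp: analytic_trig_poly_cis)
qed

lemma analytic_trig_poly_0: "analytic_trig_poly d (\<lambda>_. 0)"
  unfolding analytic_trig_poly_iff_poly by (rule exI[of _ 0]) simp

lemma analytic_trig_poly_mono: "analytic_trig_poly d f \<Longrightarrow> d \<le> e \<Longrightarrow> analytic_trig_poly e f"
  unfolding analytic_trig_poly_iff_poly by (blast intro: order_trans)

section \<open>Parseval's identity and moments of Dirichlet sums\<close>

lemma integral_norm_square_trig_poly:
  "(\<integral>t. (cmod (\<Sum>j\<le>n. a j * cis (real j * t)))\<^sup>2 \<partial>torus) = (\<Sum>j\<le>n. (cmod (a j))\<^sup>2)"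
proof -
  have "complex_of_real (\<integral>t. (cmod (\<Sum>j\<le>n. a j * cis (real j * t)))\<^sup>2 \<partial>torus)
      = (\<integral>t. complex_of_real ((cmod (\<Sum>j\<le>n. a j * cis (real j * t)))\<^sup>2) \<partial>torus)"
    by (rule integral_complex_of_real[symmetric])
  also have "\<dots> = (\<integral>t. (\<Sum>i\<le>n. \<Sum>j\<le>n. a i * cnj (a j) * cis (real_of_int (int i - int j) * t)) \<partial>torus)"
    unfolding complex_norm_square cnj_sum sum_product
    by (intro Bochner_Integration.integral_cong sum.cong refl)
       (simp add: cis_cnj cis_mult algebra_simps)
  also have "\<dots> = (\<Sum>i\<le>n. \<Sum>j\<le>n. a i * cnj (a j) * (if int i - int j = 0 then 1 else 0))"
    by (subst Bochner_Integration.integral_sum,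
        intro Bochner_Integration.integrable_sum integrable_torus_continuous continuous_intros,
        subst Bochner_Integration.integral_sum, intro integrable_torus_continuous continuous_intros)
       (simp only: integral_mult_right_zero integral_torus_cis)
  also have "\<dots> = (\<Sum>i\<le>n. \<Sum>j\<le>n. if i = j then a i * cnj (a i) else 0)"
    by (intro sum.cong refl) simp
  also have "\<dots> = (\<Sum>i\<le>n. a i * cnj (a i))"
    by simp
  also have "\<dots> = complex_of_real (\<Sum>j\<le>n. (cmod (a j))\<^sup>2)"
    by (simp only: of_real_sum complex_norm_square)
  finally show ?thesis
    by (simp only: of_real_eq_iff)
qed

lemma integral_norm_square_poly_cis:
  assumes "degree p \<le> n"
  shows "(\<integral>t. (cmod (poly p (cis t)))\<^sup>2 \<partial>torus) = (\<Sum>j\<le>n. (cmod (coeff p j))\<^sup>2)"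
proof -
  have "poly p (cis t) = (\<Sum>j\<le>n. coeff p j * cis (real j * t))" for t
    by (subst poly_as_sum_of_monoms'[OF assms, symmetric])
       (simp add: poly_sum poly_monom Complex.DeMoivre)
  then show ?thesis
    by (simp add: integral_norm_square_trig_poly)
qed

definition dirichlet_poly :: "nat \<Rightarrow> complex poly" where
  "dirichlet_poly L = (\<Sum>j<L. monom 1 j)"

lemma poly_dirichlet_poly: "poly (dirichlet_poly L) (cis t) = dirichlet_sum L t"
  by (simp add: dirichlet_poly_def dirichlet_sum_def poly_sum poly_monom Complex.DeMoivre)

lemma coeff_dirichlet_poly: "coeff (dirichlet_poly L) i = (if i < L then 1 else 0)"
  by (simp add: dirichlet_poly_def coeff_sum)

lemma degree_dirichlet_poly: "degree (dirichlet_poly L) \<le> L"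
  by (rule degree_le) (simp add: coeff_dirichlet_poly)

lemma integral_dirichlet_sum_square: "(\<integral>t. (cmod (dirichlet_sum L t))\<^sup>2 \<partial>torus) = real L"
proof -
  have "(\<integral>t. (cmod (dirichlet_sum L t))\<^sup>2 \<partial>torus) = (\<Sum>j\<le>L. (cmod (coeff (dirichlet_poly L) j))\<^sup>2)"
    using integral_norm_square_poly_cis[OF degree_dirichlet_poly] by (simp add: poly_dirichlet_poly)
  also have "\<dots> = (\<Sum>j<L. 1)"
    by (rule sum.mono_neutral_cong_right) (auto simp: coeff_dirichlet_poly)
  finally show ?thesis by simp
qed

lemma cube_le_sum_squares: "real L ^ 3 \<le> 3 * (\<Sum>m<L. (real m + 1)\<^sup>2)"
  by (induction L) (auto simp: power3_eq_cube power2_eq_square algebra_simps)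

text \<open>Parseval for the squared Dirichlet sum: its coefficients of index \<open>m < L\<close>
  are \<open>m + 1\<close>, and their squares alone add up to at least
  \<open>L^3 / 3\<close>.\<close>

lemma integral_dirichlet_sum_fourth_ge: "real L ^ 3 \<le> 3 * (\<integral>t. (cmod (dirichlet_sum L t)) ^ 4 \<partial>torus)"
proof -
  let ?q = "dirichlet_poly L * dirichlet_poly L"
  have deg: "degree ?q \<le> L + L"
    by (intro order_trans[OF degree_mult_le] add_mono degree_dirichlet_poly)
  have coeff: "coeff ?q m = of_nat (m + 1)" if "m < L" for m
  proof -
    have "coeff ?q m = (\<Sum>i\<le>m. 1)"
      unfolding coeff_mult using that by (intro sum.cong refl) (auto simp: coeff_dirichlet_poly)
    then show ?thesis by simp
  qed
  have "real L ^ 3 \<le> 3 * (\<Sum>m<L. (real m + 1)\<^sup>2)"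
    by (rule cube_le_sum_squares)
  also have "(\<Sum>m<L. (real m + 1)\<^sup>2) = (\<Sum>m<L. (cmod (coeff ?q m))\<^sup>2)"
    by (intro sum.cong refl, subst coeff) (simp_all only: lessThan_iff norm_of_nat, simp_all)
  also have "\<dots> \<le> (\<Sum>m\<le>L + L. (cmod (coeff ?q m))\<^sup>2)"
    by (rule sum_mono2) auto
  also have "\<dots> = (\<integral>t. (cmod (poly ?q (cis t)))\<^sup>2 \<partial>torus)"
    by (rule integral_norm_square_poly_cis[OF deg, symmetric])
  also have "\<dots> = (\<integral>t. (cmod (dirichlet_sum L t)) ^ 4 \<partial>torus)"
    by (simp add: poly_dirichlet_poly norm_mult power4_eq_xxxx power2_eq_square mult.assoc)
  finally show ?thesis by simp
qed

text \<open>The fourth power of the modulus has frequencies between \<open>-2 * L\<close> and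
  \<open>2 * L\<close>; the factor \<open>cis (2 * L * t)\<close> moves them to nonnegative ones. It
  is \<open>2 * pi / N\<close>-periodic whenever \<open>N\<close> divides \<open>L\<close>, hence
  passes through the periodization.\<close>

definition peak :: "nat \<Rightarrow> real \<Rightarrow> complex" where
  "peak L t = cis (2 * real L * t) * of_real ((cmod (dirichlet_sum L t)) ^ 4)"

lemma analytic_trig_poly_peak: "analytic_trig_poly (4 * L) (peak L)"
proof -
  \<comment> \<open>The conjugate Dirichlet sum shifted by \<open>L\<close> to be analytic; the peak
    is then the square of \<open>dirichlet_poly L * q\<close>.\<close>
  define q where "q = (\<Sum>j<L. monom (1::complex) (L - j))"
  have q: "poly q (cis t) = cis (real L * t) * cnj (dirichlet_sum L t)" for t
    unfolding q_def poly_sum dirichlet_sum_def cnj_sum sum_distrib_left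
    by (intro sum.cong refl)
       (simp add: poly_monom Complex.DeMoivre cis_cnj cis_mult of_nat_diff algebra_simps)
  have dq: "degree q \<le> L"
    unfolding q_def by (intro degree_sum_le) (auto intro: order_trans[OF degree_monom_le])
  have "degree ((dirichlet_poly L * q) * (dirichlet_poly L * q)) \<le> (L + L) + (L + L)"
    by (intro order_trans[OF degree_mult_le] add_mono degree_dirichlet_poly dq)
  moreover have "poly ((dirichlet_poly L * q) * (dirichlet_poly L * q)) (cis t) = peak L t" for t
  proof -
    have "poly (dirichlet_poly L * q) (cis t)
        = cis (real L * t) * (dirichlet_sum L t * cnj (dirichlet_sum L t))"
      by (simp add: q poly_dirichlet_poly mult_ac)
    also have "\<dots> = cis (real L * t) * of_real ((cmod (dirichlet_sum L t))\<^sup>2)"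
      by (simp only: complex_norm_square)
    finally have eq: "poly (dirichlet_poly L * q) (cis t)
        = cis (real L * t) * of_real ((cmod (dirichlet_sum L t))\<^sup>2)" .
    have "cis (2 * real L * t) = cis (real L * t) * cis (real L * t)"
      by (simp add: cis_mult mult_ac)
    then show ?thesis
      unfolding poly_mult[of "dirichlet_poly L * q" "dirichlet_poly L * q"] eq peak_def
      by (simp add: power4_eq_xxxx power2_eq_square mult_ac)
  qed
  ultimately show ?thesis
    unfolding analytic_trig_poly_iff_poly
    by (intro exI[of _ "(dirichlet_poly L * q) * (dirichlet_poly L * q)"]) (auto simp: fun_eq_iff)
qed

section \<open>Periodized peaks and their pairwise products\<close>

definition peak_mean :: "nat \<Rightarrow> nat \<Rightarrow> real \<Rightarrow> real" where
  "peak_mean L N = star_mean N (\<lambda>t. (cmod (dirichlet_sum L t)) ^ 4)"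

lemma continuous_on_peak_mean: "continuous_on UNIV (peak_mean L N)"
  unfolding peak_mean_def by (intro continuous_on_star_mean continuous_intros)

lemma peak_mean_nonneg: "peak_mean L N t \<ge> 0"
  unfolding peak_mean_def star_mean_def by (simp add: sum_nonneg)

lemma integral_peak_mean:
  "N > 0 \<Longrightarrow> integral\<^sup>L torus (peak_mean L N) = (\<integral>t. (cmod (dirichlet_sum L t)) ^ 4 \<partial>torus)"
  unfolding peak_mean_def
  by (intro integral_star_mean continuous_intros) (simp_all add: dirichlet_sum_periodic)

lemma norm_star_mean_peak:
  assumes "N dvd L" "N > 0"
  shows "cmod (star_mean N (peak L) t) = peak_mean L N t"
proof -
  obtain q where L: "L = N * q" using assms by blast
  have "cis (2 * real L * (t + 2 * pi * real j / real N)) = cis (2 * real L * t)" for j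
  proof -
    have "cis (2 * real L * (2 * pi * real j / real N)) = cis (2 * pi * real (2 * q * j))"
      using assms by (simp add: L field_simps)
    also have "\<dots> = 1"
      by (rule cis_multiple_2pi) simp
    finally show ?thesis
      by (simp add: distrib_left flip: cis_mult)
  qed
  then have "star_mean N (peak L) t = cis (2 * real L * t) * of_real (peak_mean L N t)"
    by (simp add: star_mean_def peak_mean_def peak_def scaleR_conv_of_real sum_distrib_left mult_ac)
  then show ?thesis
    by (simp add: norm_mult peak_mean_nonneg del: of_real_power)
qed

text \<open>The l2 norm of the \<open>N\<close> values of the squared modulus is at most their l1
  norm, so the root of a fourth moment is traded for a second moment at the price of
  \<open>sqrt N\<close>.\<close>

lemma sqrt_peak_mean_le:
  assumes "N > 0"
  shows "sqrt (peak_mean L N t) \<le> sqrt (real N) * star_mean N (\<lambda>t. (cmod (dirichlet_sum L t))\<^sup>2) t"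
proof -
  define h where "h j = (cmod (dirichlet_sum L (t + 2 * pi * real j / real N)))\<^sup>2" for j
  have "peak_mean L N t = (\<Sum>j<N. (h j)\<^sup>2) / real N"
    by (simp add: peak_mean_def star_mean_def h_def flip: power_mult)
  then have "sqrt (peak_mean L N t) = L2_set h {..<N} / sqrt (real N)"
    by (simp add: L2_set_def real_sqrt_divide)
  also have "\<dots> \<le> (\<Sum>j<N. h j) / sqrt (real N)"
    by (intro divide_right_mono L2_set_le_sum) (auto simp: h_def)
  also have "\<dots> = sqrt (real N) * ((\<Sum>j<N. h j) / real N)"
    using assms by (simp add: field_simps real_sqrt_mult_self flip: real_sqrt_mult)
  finally show ?thesis
    by (simp add: star_mean_def h_def)
qed

text \<open>After passing to second moments, the factor at scale \<open>M\<close> is bounded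
  pointwise by a multiple of \<open>L^2 / M\<close>, and the one at scale \<open>N\<close> has mean
  \<open>L\<close>. The gain is the ratio \<open>N / M\<close>, small when the scales are far
  apart.\<close>

lemma integral_sqrt_peak_mean_mult_le:
  assumes M: "0 < M" "M \<le> L"
  shows "(\<integral>t. sqrt (peak_mean L N t) * sqrt (peak_mean L M t) \<partial>torus)
      \<le> 2 * sqrt (real N / real M) * real L ^ 3"
\<comment> \<open>For \<open>N = 0\<close> the average is an empty sum, so both sides
  vanish.\<close>
proof (cases "N > 0")
  case False
  then show ?thesis by (simp add: peak_mean_def star_mean_def)
next
  case N: True
  define H where "H K = star_mean K (\<lambda>t. (cmod (dirichlet_sum L t))\<^sup>2)" for K
  have cH: "continuous_on UNIV (H K)" for K
    unfolding H_def by (intro continuous_on_star_mean continuous_intros)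
  have H0: "H K t \<ge> 0" for K t
    by (simp add: H_def star_mean_def sum_nonneg)
  have intH: "integral\<^sup>L torus (H K) = real L" if "K > 0" for K
    unfolding H_def
    by (subst integral_star_mean)
       (auto intro!: continuous_intros simp: dirichlet_sum_periodic integral_dirichlet_sum_square that)
  have HM: "H M t \<le> 2 * (real L)\<^sup>2 / real M" for t
  proof -
    have "H M t \<le> real L * (real L / real M + 1)"
      unfolding H_def by (rule star_mean_dirichlet_sum_le[OF M(1)])
    also have "\<dots> \<le> real L * (real L / real M + real L / real M)"
      using M by (intro mult_left_mono add_left_mono) (auto simp: divide_simps)
    finally show ?thesis by (simp add: power2_eq_square mult_ac)
  qed
  have "(\<integral>t. sqrt (peak_mean L N t) * sqrt (peak_mean L M t) \<partial>torus)
      \<le> (\<integral>t. (sqrt (real N) * sqrt (real M) * (2 * (real L)\<^sup>2 / real M)) * H N t \<partial>torus)"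
  proof (intro integral_mono integrable_torus_continuous continuous_intros continuous_on_peak_mean cH)
    fix t
    have "sqrt (peak_mean L N t) * sqrt (peak_mean L M t) \<le> (sqrt (real N) * H N t) * (sqrt (real M) * H M t)"
      unfolding H_def using N M
      by (intro mult_mono sqrt_peak_mean_le) (auto simp: peak_mean_nonneg star_mean_def sum_nonneg)
    also have "\<dots> \<le> (sqrt (real N) * H N t) * (sqrt (real M) * (2 * (real L)\<^sup>2 / real M))"
      by (intro mult_left_mono HM) (auto simp: H0)
    finally show "sqrt (peak_mean L N t) * sqrt (peak_mean L M t)
        \<le> (sqrt (real N) * sqrt (real M) * (2 * (real L)\<^sup>2 / real M)) * H N t"
      by (simp add: mult_ac)
  qed
  also have "\<dots> = (sqrt (real N) * sqrt (real M) * (2 * (real L)\<^sup>2 / real M)) * real L"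
    by (simp add: intH N)
  also have "\<dots> = 2 * (sqrt (real N) * (sqrt (real M) / real M)) * real L ^ 3"
    by (simp add: power2_eq_square power3_eq_cube)
  also have "sqrt (real N) * (sqrt (real M) / real M) = sqrt (real N / real M)"
    using M by (simp add: real_sqrt_divide field_simps)
  finally show ?thesis .
qed

text \<open>The counterpart for independent variables: each mean is at most
  \<open>sqrt K * L\<close> at its scale \<open>K\<close>, and \<open>M \<le> L\<close> gives the
  same bound as for identical variables.\<close>

lemma integral_sqrt_peak_mean_prod_le:
  assumes M: "0 < M" "M \<le> L"
  shows "(\<integral>t. sqrt (peak_mean L N t) \<partial>torus) * (\<integral>t. sqrt (peak_mean L M t) \<partial>torus)
      \<le> 2 * sqrt (real N / real M) * real L ^ 3"
proof (cases "N > 0")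
  case False
  then show ?thesis by (simp add: peak_mean_def star_mean_def)
next
  case N: True
  have *: "(\<integral>t. sqrt (peak_mean L K t) \<partial>torus) \<le> sqrt (real K) * real L" if K: "K > 0" for K
  proof -
    have "(\<integral>t. sqrt (peak_mean L K t) \<partial>torus)
        \<le> (\<integral>t. sqrt (real K) * star_mean K (\<lambda>t. (cmod (dirichlet_sum L t))\<^sup>2) t \<partial>torus)"
      by (intro integral_mono integrable_torus_continuous continuous_intros continuous_on_peak_mean
          continuous_on_star_mean sqrt_peak_mean_le K)
    also have "\<dots> = sqrt (real K) * real L"
      by (simp, subst integral_star_mean)
         (auto intro!: continuous_intros simp: dirichlet_sum_periodic integral_dirichlet_sum_square K)
    finally show ?thesis .
  qed
  have "(\<integral>t. sqrt (peak_mean L N t) \<partial>torus) * (\<integral>t. sqrt (peak_mean L M t) \<partial>torus)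
      \<le> (sqrt (real N) * real L) * (sqrt (real M) * real L)"
    using N M by (intro mult_mono *) (auto intro!: integral_nonneg_AE simp: peak_mean_nonneg)
  also have "\<dots> = sqrt (real N / real M) * (real M * (real L)\<^sup>2)"
    using M by (simp add: real_sqrt_divide power2_eq_square field_simps)
  also have "\<dots> \<le> sqrt (real N / real M) * (real L * (real L)\<^sup>2)"
    using M by (intro mult_left_mono mult_right_mono) auto
  also have "\<dots> \<le> 2 * sqrt (real N / real M) * real L ^ 3"
    by (simp add: power2_eq_square power3_eq_cube)
  finally show ?thesis .
qed

section \<open>Lower bound from nearly disjoint peaks\<close>

text \<open>Replacing a sum of two numbers by a bound for the larger leaves the smaller as error.
  Here \<open>min ?A (x b)\<close> is covered by the products: if some earlier \<open>x i\<close> is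
  at least \<open>x b\<close>, its product alone suffices; otherwise each product dominates
  \<open>x i\<close>, and their sum dominates the l2 norm.\<close>

lemma sum_le_L2_set_plus_sqrt_products:
  fixes x :: "nat \<Rightarrow> real"
  assumes "\<And>i. x i \<ge> 0"
  shows "(\<Sum>i<b. x i) \<le> L2_set x {..<b} + (\<Sum>j<b. \<Sum>i<j. sqrt (x i) * sqrt (x j))"
proof (induction b)
  case 0
  then show ?case by simp
next
  case (Suc b)
  let ?A = "L2_set x {..<b}" and ?P = "\<Sum>i<b. sqrt (x i) * sqrt (x b)"
  have suc: "L2_set x {..<Suc b} = sqrt ((x b)\<^sup>2 + ?A\<^sup>2)"
    by (simp add: L2_set_def lessThan_Suc sum_nonneg)
  have ge: "x b \<le> L2_set x {..<Suc b}" "?A \<le> L2_set x {..<Suc b}"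
    unfolding suc by (auto intro: real_le_rsqrt)
  have "min ?A (x b) \<le> ?P"
  proof (cases "\<exists>i<b. x b \<le> x i")
    case True
    then obtain i where i: "i < b" "x b \<le> x i" by blast
    have "x b = sqrt (x b) * sqrt (x b)" using assms by simp
    also have "\<dots> \<le> sqrt (x i) * sqrt (x b)"
      using i assms by (intro mult_right_mono) auto
    also have "\<dots> \<le> ?P"
      by (rule member_le_sum) (use i assms in auto)
    finally show ?thesis by simp
  next
    case False
    have "?A \<le> (\<Sum>i<b. x i)"
      using assms by (intro L2_set_le_sum) auto
    also have "\<dots> \<le> ?P"
    proof (rule sum_mono)
      fix i assume "i \<in> {..<b}"
      then have "x i \<le> x b" using False by auto
      then have "sqrt (x i) * sqrt (x i) \<le> sqrt (x i) * sqrt (x b)"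
        using assms by (intro mult_left_mono) auto
      then show "x i \<le> sqrt (x i) * sqrt (x b)" using assms by simp
    qed
    finally show ?thesis by simp
  qed
  then have "?A + x b \<le> L2_set x {..<Suc b} + ?P"
    using ge by (simp add: min_def split: if_splits)
  then show ?case
    using Suc by simp
qed

lemma sum_geometric_sixteenth_le: "(\<Sum>i<j. (1/16::real) ^ (j - i)) \<le> 1/15"
proof (induction j)
  case 0
  then show ?case by simp
next
  case (Suc j)
  have "(\<Sum>i<j. (1/16::real) ^ (Suc j - i)) = (\<Sum>i<j. (1/16) ^ (j - i)) / 16"
    unfolding sum_divide_distrib by (intro sum.cong refl) (simp add: Suc_diff_le)
  then show ?case
    using Suc by simp
qed

text \<open>All periodized peaks have the same mean \<open>c\<close>, while the means of the
  pairwise products sum to a small part of \<open>b * c\<close>. The joint law enters through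
  \<open>pair\<close>, which is checked separately for identical and for independent
  variables.\<close>

lemma (in torus_coupling) integral_L2_set_peak_mean_ge:
  fixes \<sigma> K :: "nat \<Rightarrow> nat"
  assumes \<sigma>: "\<And>i. i < b \<Longrightarrow> \<sigma> i \<in> I" and K: "\<And>i. i < b \<Longrightarrow> K i > 0"
    and growth: "\<And>i j. i < j \<Longrightarrow> j < b \<Longrightarrow> 256 ^ (j - i) * K i \<le> K j"
    and pair: "\<And>i j. i < j \<Longrightarrow> j < b \<Longrightarrow>
      (\<integral>w. sqrt (peak_mean L (K i) (X (\<sigma> i) w)) * sqrt (peak_mean L (K j) (X (\<sigma> j) w)) \<partial>W)
        \<le> 2 * sqrt (real (K i) / real (K j)) * real L ^ 3"
  shows "real b / 2 * (\<integral>t. (cmod (dirichlet_sum L t)) ^ 4 \<partial>torus)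
    \<le> (\<integral>w. L2_set (\<lambda>i. peak_mean L (K i) (X (\<sigma> i) w)) {..<b} \<partial>W)"
proof -
  define c where "c = (\<integral>t. (cmod (dirichlet_sum L t)) ^ 4 \<partial>torus)"
  define G where "G i w = peak_mean L (K i) (X (\<sigma> i) w)" for i w
  have c0: "c \<ge> 0"
    unfolding c_def by (auto intro!: integral_nonneg_AE)
  have Lc: "real L ^ 3 \<le> 3 * c"
    unfolding c_def by (rule integral_dirichlet_sum_fourth_ge)
  have G0: "G i w \<ge> 0" for i w
    by (simp add: G_def peak_mean_nonneg)
  have intG: "integrable W (G i)" if "i < b" for i
    unfolding G_def using \<sigma>[OF that] continuous_on_peak_mean by (rule integrable_coupling)
  have EG: "integral\<^sup>L W (G i) = c" if "i < b" for i
    unfolding G_def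
    using integral_coupling[OF \<sigma>[OF that] continuous_on_peak_mean] integral_peak_mean[OF K[OF that]]
    by (simp add: c_def)
  have measG: "G i \<in> borel_measurable W" if "i < b" for i
    using intG[OF that] by (rule borel_measurable_integrable)
  have intL: "integrable W (\<lambda>w. L2_set (\<lambda>i. G i w) {..<b})"
  proof (rule Bochner_Integration.integrable_bound)
    show "integrable W (\<lambda>w. \<Sum>i<b. G i w)"
      by (intro Bochner_Integration.integrable_sum intG) simp
    have [measurable]: "G i \<in> borel_measurable W" if "i \<in> {..<b}" for i
      using that measG by simp
    show "(\<lambda>w. L2_set (\<lambda>i. G i w) {..<b}) \<in> borel_measurable W"
      unfolding L2_set_def by measurable
    show "AE w in W. norm (L2_set (\<lambda>i. G i w) {..<b}) \<le> norm (\<Sum>i<b. G i w)"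
      by (auto simp: G0 sum_nonneg intro!: L2_set_le_sum)
  qed
  have intP: "integrable W (\<lambda>w. sqrt (G i w) * sqrt (G j w))" if "i < b" "j < b" for i j
  proof (rule Bochner_Integration.integrable_bound)
    show "integrable W (\<lambda>w. G i w + G j w)"
      using that by (intro Bochner_Integration.integrable_add intG)
    show "(\<lambda>w. sqrt (G i w) * sqrt (G j w)) \<in> borel_measurable W"
      using measG[OF that(1)] measG[OF that(2)] by measurable
    have "sqrt (G i w) * sqrt (G j w) \<le> G i w + G j w" for w
      using sum_squares_bound[of "sqrt (G i w)" "sqrt (G j w)"] G0[of i w] G0[of j w]
      by (simp add: abs_of_nonneg)
    then show "AE w in W. norm (sqrt (G i w) * sqrt (G j w)) \<le> norm (G i w + G j w)"
      by (simp add: G0 abs_mult)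
  qed
  \<comment> \<open>The factor 6 combines the 2 of \<open>pair\<close> with
    \<open>L^3 \<le> 3 * c\<close>; growth by 256 per index becomes decay by 16 under the
    root.\<close>
  have P: "(\<integral>w. sqrt (G i w) * sqrt (G j w) \<partial>W) \<le> 6 * c * (1/16) ^ (j - i)" if "i < j" "j < b" for i j
  proof -
    have Kj: "real (K j) > 0" using K that by simp
    have "real (256 ^ (j - i) * K i) \<le> real (K j)"
      using growth[OF that] by (simp only: of_nat_le_iff)
    then have "real (K i) / real (K j) \<le> (1/256) ^ (j - i)"
      using Kj by (simp add: power_divide field_simps)
    then have "sqrt (real (K i) / real (K j)) \<le> sqrt ((1/256) ^ (j - i))"
      by (rule real_sqrt_le_mono)
    also have "\<dots> = (1/16) ^ (j - i)"
    proof -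
      have "sqrt (1/256) = (1/16::real)"
        by (rule real_sqrt_unique) (simp_all add: power2_eq_square)
      then show ?thesis by (simp only: real_sqrt_power)
    qed
    finally have sq: "sqrt (real (K i) / real (K j)) \<le> (1/16) ^ (j - i)" .
    have "(\<integral>w. sqrt (G i w) * sqrt (G j w) \<partial>W) \<le> 2 * sqrt (real (K i) / real (K j)) * real L ^ 3"
      unfolding G_def by (rule pair[OF that])
    also have "\<dots> \<le> 2 * (1/16) ^ (j - i) * (3 * c)"
      using Lc sq by (intro mult_mono) auto
    finally show ?thesis by (simp add: mult_ac)
  qed
  have "real b * c = (\<integral>w. (\<Sum>i<b. G i w) \<partial>W)"
    by (subst Bochner_Integration.integral_sum) (auto simp: EG intG)
  also have "\<dots> \<le> (\<integral>w. L2_set (\<lambda>i. G i w) {..<b} + (\<Sum>j<b. \<Sum>i<j. sqrt (G i w) * sqrt (G j w)) \<partial>W)"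
    by (intro integral_mono Bochner_Integration.integrable_add Bochner_Integration.integrable_sum
        intG intL intP sum_le_L2_set_plus_sqrt_products G0) auto
  also have "\<dots> = (\<integral>w. L2_set (\<lambda>i. G i w) {..<b} \<partial>W)
      + (\<Sum>j<b. \<Sum>i<j. \<integral>w. sqrt (G i w) * sqrt (G j w) \<partial>W)"
  proof -
    have 1: "integrable W (\<lambda>w. \<Sum>i<j. sqrt (G i w) * sqrt (G j w))" if "j < b" for j
      using that by (intro Bochner_Integration.integrable_sum intP) auto
    have "(\<integral>w. (\<Sum>j<b. \<Sum>i<j. sqrt (G i w) * sqrt (G j w)) \<partial>W)
        = (\<Sum>j<b. \<integral>w. (\<Sum>i<j. sqrt (G i w) * sqrt (G j w)) \<partial>W)"
      by (rule Bochner_Integration.integral_sum) (auto intro: 1)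
    also have "\<dots> = (\<Sum>j<b. \<Sum>i<j. \<integral>w. sqrt (G i w) * sqrt (G j w) \<partial>W)"
      by (intro sum.cong refl Bochner_Integration.integral_sum intP) auto
    moreover have "integrable W (\<lambda>w. \<Sum>j<b. \<Sum>i<j. sqrt (G i w) * sqrt (G j w))"
      by (intro Bochner_Integration.integrable_sum 1) auto
    ultimately show ?thesis
      using intL by simp
  qed
  also have "(\<Sum>j<b. \<Sum>i<j. \<integral>w. sqrt (G i w) * sqrt (G j w) \<partial>W) \<le> (\<Sum>j<b. \<Sum>i<j. 6 * c * (1/16) ^ (j - i))"
    by (intro sum_mono P) auto
  also have "\<dots> = (\<Sum>j<b. 6 * c * (\<Sum>i<j. (1/16) ^ (j - i)))"
    by (simp add: sum_distrib_left)
  also have "\<dots> \<le> (\<Sum>j<b. 6 * c * (1/15))"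
    using c0 by (intro sum_mono mult_left_mono sum_geometric_sixteenth_le) auto
  \<comment> \<open>The error is the fraction 6/15 of \<open>b * c\<close>, which is below one
    half.\<close>
  finally have "real b * c \<le> (\<integral>w. L2_set (\<lambda>i. G i w) {..<b} \<partial>W) + real b * c * (6 / 15)"
    by simp
  moreover have "0 \<le> real b * c" using c0 by simp
  ultimately have "real b / 2 * c \<le> (\<integral>w. L2_set (\<lambda>i. G i w) {..<b} \<partial>W)"
    by argo
  then show ?thesis
    by (simp add: c_def G_def)
qed

text \<open>Independence of two coordinates: the integrand is a product over all of \<open>I\<close>
  with every other factor equal to 1.\<close>

lemma integral_PiM_mult_two:
  fixes \<phi> \<psi> :: "real \<Rightarrow> real" and I :: "'i set"
  assumes "finite I" "k \<in> I" "l \<in> I" "k \<noteq> l"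
    and \<phi>: "continuous_on UNIV \<phi>" and \<psi>: "continuous_on UNIV \<psi>"
  shows "(\<integral>x. \<phi> (x k) * \<psi> (x l) \<partial>PiM I (\<lambda>_. torus)) = integral\<^sup>L torus \<phi> * integral\<^sup>L torus \<psi>"
proof -
  interpret torus: prob_space torus by (rule prob_space_torus)
  interpret product_sigma_finite "\<lambda>_. torus" by standard
  define F where "F i = (if i = k then \<phi> else if i = l then \<psi> else (\<lambda>_. 1))" for i
  have two: "(\<Prod>i\<in>I. h i) = h k * h l" if "\<And>i. i \<in> I - {k, l} \<Longrightarrow> h i = 1" for h :: "'i \<Rightarrow> real"
  proof -
    have "(\<Prod>i\<in>I. h i) = (\<Prod>i\<in>{k, l}. h i)"
      using assms that by (intro prod.mono_neutral_right) auto
    then show ?thesis using assms by simp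
  qed
  have "(\<integral>x. \<phi> (x k) * \<psi> (x l) \<partial>PiM I (\<lambda>_. torus)) = (\<integral>x. (\<Prod>i\<in>I. F i (x i)) \<partial>PiM I (\<lambda>_. torus))"
    using assms by (subst two) (auto simp: F_def)
  also have "\<dots> = (\<Prod>i\<in>I. integral\<^sup>L torus (F i))"
    using \<phi> \<psi> by (intro product_integral_prod assms) (auto simp: F_def integrable_torus_continuous)
  also have "\<dots> = integral\<^sup>L torus \<phi> * integral\<^sup>L torus \<psi>"
    using assms torus.prob_space by (subst two) (auto simp: F_def)
  finally show ?thesis .
qed

section \<open>The equivalence\<close>

text \<open>Zero divides only zero, so a zero term would be followed by another, against strict
  growth.\<close>

lemma dvd_chain_pos:
  fixes N :: "nat \<Rightarrow> nat"
  assumes "\<forall>k\<ge>1. N k dvd N (Suc k)" "\<forall>k\<ge>1. N k < N (Suc k)" "k \<ge> 1"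
  shows "N k > 0"
proof (rule ccontr)
  assume "\<not> N k > 0"
  then have "0 dvd N (Suc k)" using assms(1,3) by (metis not_gr_zero)
  then show False using assms(2,3) by auto
qed

lemma dvd_chain_dvd:
  fixes N :: "nat \<Rightarrow> nat"
  assumes "\<forall>k\<ge>1. N k dvd N (Suc k)" "k \<ge> 1"
  shows "N k dvd N (k + m)"
  by (induction m) (use assms in \<open>auto intro: dvd_trans\<close>)

text \<open>A strictly larger multiple is at least twice as large, so each step doubles
  \<open>N\<close>.\<close>

lemma dvd_chain_growth:
  fixes N :: "nat \<Rightarrow> nat"
  assumes "\<forall>k\<ge>1. N k dvd N (Suc k)" "\<forall>k\<ge>1. N k < N (Suc k)" "k \<ge> 1"
  shows "2 ^ m * N k \<le> N (k + m)"
proof (induction m)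
  case 0
  then show ?case by simp
next
  case (Suc m)
  have km: "k + m \<ge> 1" using assms by simp
  obtain q where q: "N (Suc (k + m)) = N (k + m) * q"
    using assms(1) km by blast
  have "N (k + m) < N (k + m) * q" using assms(2) km q by metis
  then have "q \<ge> 2" by (cases q rule: nat.exhaust; cases "q - 1") auto
  then have "N (k + m) * 2 \<le> N (Suc (k + m))" using q by simp
  then show ?case using Suc by simp
qed

text \<open>Tests a candidate constant \<open>c\<close> on \<open>b\<close> equal peaks: the
  unperiodized side is \<open>sqrt b\<close> times their common mean \<open>e\<close>, the
  periodized side at least \<open>b / 2 * e\<close>.\<close>

lemma (in torus_coupling) lower_constant_le:
  fixes d N :: "nat \<Rightarrow> nat" and c :: real
  assumes Ndvd: "\<forall>k\<ge>1. N k dvd N (Suc k)" and Nless: "\<forall>k\<ge>1. N k < N (Suc k)"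
    and k: "k \<ge> 1" and n: "n = k + 8 * b" and I: "{1..n} \<subseteq> I"
    and d: "\<And>l. l \<ge> k \<Longrightarrow> 4 * N n \<le> d l"
    and pair: "\<And>i j K M. i \<in> I \<Longrightarrow> j \<in> I \<Longrightarrow> i \<noteq> j \<Longrightarrow> 0 < M \<Longrightarrow> M \<le> N n \<Longrightarrow>
      (\<integral>w. sqrt (peak_mean (N n) K (X i w)) * sqrt (peak_mean (N n) M (X j w)) \<partial>W)
        \<le> 2 * sqrt (real K / real M) * real (N n) ^ 3"
    and lower: "\<And>f. (\<forall>k\<in>{1..n}. analytic_trig_poly (d k) (f k)) \<Longrightarrow>
      c * (\<integral>w. L2_set (\<lambda>k. cmod (cond_exp_star (N k) (f k) (X k w))) {1..n} \<partial>W)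
        \<le> (\<integral>t. L2_set (\<lambda>k. cmod (f k t)) {1..n} \<partial>torus)"
    and c: "c \<ge> 0"
  shows "c * sqrt (real b) \<le> 2"
proof (cases "b = 0")
  case True
  then show ?thesis by simp
next
  case b: False
  define L where "L = N n"
  \<comment> \<open>Spacing 8 yields the growth factor \<open>2 ^ 8 = 256\<close> between chosen
    indices; they all lie below \<open>n\<close>, so each \<open>N (\<sigma> i)\<close> divides
    \<open>L\<close>.\<close>
  define \<sigma> where "\<sigma> i = k + 8 * i" for i
  define f where "f l = (if l \<in> \<sigma> ` {..<b} then peak L else (\<lambda>_. 0))" for l
  define e where "e = (\<integral>t. (cmod (dirichlet_sum L t)) ^ 4 \<partial>torus)"
  have Lpos: "L > 0"
    unfolding L_def using dvd_chain_pos[OF Ndvd Nless] k n by simp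
  have epos: "e > 0"
  proof -
    have "0 < real L ^ 3" using Lpos by simp
    also have "\<dots> \<le> 3 * e" unfolding e_def by (rule integral_dirichlet_sum_fourth_ge)
    finally show ?thesis by simp
  qed
  have \<sigma>I: "\<sigma> i \<in> {1..n}" "\<sigma> i \<in> I" if "i < b" for i
    using that k n I by (auto simp: \<sigma>_def)
  have inj: "inj_on \<sigma> A" for A
    by (auto simp: inj_on_def \<sigma>_def)
  have \<sigma>N: "N (\<sigma> i) > 0" "N (\<sigma> i) dvd L" "N (\<sigma> i) \<le> L" if "i < b" for i
  proof -
    show "N (\<sigma> i) > 0"
      using dvd_chain_pos[OF Ndvd Nless] k by (simp add: \<sigma>_def)
    have "N (\<sigma> i) dvd N (\<sigma> i + (n - \<sigma> i))"
      using k by (intro dvd_chain_dvd[OF Ndvd]) (simp add: \<sigma>_def)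
    then show "N (\<sigma> i) dvd L"
      using \<sigma>I[OF that] by (simp add: L_def)
    then show "N (\<sigma> i) \<le> L"
      using Lpos by (rule dvd_imp_le)
  qed
  have window: "L2_set x {1..n} = L2_set (\<lambda>i. x (\<sigma> i)) {..<b}" if "\<And>l. l \<notin> \<sigma> ` {..<b} \<Longrightarrow> x l = 0" for x
  proof -
    have "(\<Sum>l\<in>{1..n}. (x l)\<^sup>2) = (\<Sum>l\<in>\<sigma> ` {..<b}. (x l)\<^sup>2)"
      using \<sigma>I that by (intro sum.mono_neutral_right) auto
    also have "\<dots> = (\<Sum>i<b. (x (\<sigma> i))\<^sup>2)"
      by (simp add: sum.reindex[OF inj] o_def)
    finally show ?thesis by (simp add: L2_set_def)
  qed
  have "real b / 2 * e \<le> (\<integral>w. L2_set (\<lambda>i. peak_mean L (N (\<sigma> i)) (X (\<sigma> i) w)) {..<b} \<partial>W)"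
    unfolding e_def
  proof (rule integral_L2_set_peak_mean_ge)
    fix i j assume ij: "i < j" "j < b"
    show "256 ^ (j - i) * N (\<sigma> i) \<le> N (\<sigma> j)"
    proof -
      have "2 ^ (8 * (j - i)) * N (\<sigma> i) \<le> N (\<sigma> i + 8 * (j - i))"
        using k by (intro dvd_chain_growth[OF Ndvd Nless]) (simp add: \<sigma>_def)
      moreover have "\<sigma> i + 8 * (j - i) = \<sigma> j"
        using ij by (simp add: \<sigma>_def)
      ultimately show ?thesis by (simp add: power_mult)
    qed
    show "(\<integral>w. sqrt (peak_mean L (N (\<sigma> i)) (X (\<sigma> i) w)) * sqrt (peak_mean L (N (\<sigma> j)) (X (\<sigma> j) w)) \<partial>W)
        \<le> 2 * sqrt (real (N (\<sigma> i)) / real (N (\<sigma> j))) * real L ^ 3"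
      unfolding L_def using ij \<sigma>I[of i] \<sigma>I[of j] \<sigma>N[of j]
      by (intro pair) (auto simp: L_def \<sigma>_def)
  qed (use \<sigma>I \<sigma>N in auto)
  also have "\<dots> = (\<integral>w. L2_set (\<lambda>l. cmod (cond_exp_star (N l) (f l) (X l w))) {1..n} \<partial>W)"
  proof (intro Bochner_Integration.integral_cong refl)
    fix w
    have "L2_set (\<lambda>l. cmod (cond_exp_star (N l) (f l) (X l w))) {1..n}
        = L2_set (\<lambda>i. cmod (cond_exp_star (N (\<sigma> i)) (f (\<sigma> i)) (X (\<sigma> i) w))) {..<b}"
      by (rule window) (simp add: f_def cond_exp_star_def)
    also have "\<dots> = L2_set (\<lambda>i. peak_mean L (N (\<sigma> i)) (X (\<sigma> i) w)) {..<b}"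
      using \<sigma>N by (intro L2_set_cong refl) (simp add: f_def cond_exp_star_eq_star_mean norm_star_mean_peak)
    finally show "L2_set (\<lambda>i. peak_mean L (N (\<sigma> i)) (X (\<sigma> i) w)) {..<b}
        = L2_set (\<lambda>l. cmod (cond_exp_star (N l) (f l) (X l w))) {1..n}" ..
  qed
  finally have "c * (real b / 2 * e)
      \<le> c * (\<integral>w. L2_set (\<lambda>l. cmod (cond_exp_star (N l) (f l) (X l w))) {1..n} \<partial>W)"
    using c by (rule mult_left_mono)
  also have "\<dots> \<le> (\<integral>t. L2_set (\<lambda>l. cmod (f l t)) {1..n} \<partial>torus)"
  proof (rule lower, intro ballI)
    fix l
    show "analytic_trig_poly (d l) (f l)"
    proof (cases "l \<in> \<sigma> ` {..<b}")
      case True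
      then have "4 * L \<le> d l"
        unfolding L_def by (intro d) (auto simp: \<sigma>_def)
      then show ?thesis
        using True analytic_trig_poly_mono[OF analytic_trig_poly_peak] by (simp add: f_def)
    next
      case False
      then show ?thesis by (simp add: f_def analytic_trig_poly_0)
    qed
  qed
  also have "\<dots> = (\<integral>t. sqrt (real b) * (cmod (dirichlet_sum L t)) ^ 4 \<partial>torus)"
  proof (intro Bochner_Integration.integral_cong refl)
    fix t
    have "L2_set (\<lambda>l. cmod (f l t)) {1..n} = L2_set (\<lambda>i. cmod (f (\<sigma> i) t)) {..<b}"
      by (rule window) (simp add: f_def)
    also have "\<dots> = L2_set (\<lambda>i. (cmod (dirichlet_sum L t)) ^ 4) {..<b}"
      by (intro L2_set_cong refl) (simp add: f_def peak_def norm_mult norm_power)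
    also have "\<dots> = sqrt (real b) * (cmod (dirichlet_sum L t)) ^ 4"
      by (simp add: L2_set_constant)
    finally show "L2_set (\<lambda>l. cmod (f l t)) {1..n} = sqrt (real b) * (cmod (dirichlet_sum L t)) ^ 4" .
  qed
  also have "\<dots> = sqrt (real b) * e"
    by (simp add: e_def)
  finally have "(c * real b) * e \<le> (2 * sqrt (real b)) * e"
    by (simp add: mult_ac)
  then have "c * real b \<le> 2 * sqrt (real b)"
    using epos by (simp only: mult_le_cancel_right_pos)
  then have "(c * sqrt (real b)) * sqrt (real b) \<le> 2 * sqrt (real b)"
    by (simp add: mult.assoc)
  then show ?thesis
    using b by (simp add: mult_le_cancel_right)
qed

lemma ex_sqrt_gt:
  fixes c :: real
  assumes "c > 0"
  shows "\<exists>b::nat. c * sqrt (real b) > 2"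
proof -
  obtain m :: nat where "real m > 2 / c" using reals_Archimedean2 by blast
  then have "c * sqrt (real (m\<^sup>2)) > 2" using assms by (simp add: field_simps)
  then show ?thesis by blast
qed

theorem theorem2p3:
  fixes d N :: "nat \<Rightarrow> nat"
  assumes dpos: "\<forall>k\<ge>1. d k > 0"
    and lac: "lacunary d"
    and Ndvd: "\<forall>k\<ge>1. N k dvd N (Suc k)"
    and Nless: "\<forall>k\<ge>1. N k < N (Suc k)"
  shows "((\<exists>(a::nat) (C::real). \<forall>k\<ge>1. real (d k) \<le> C * real (N (k + a)))
        \<longleftrightarrow>
         (\<exists>c>0. \<forall>n. \<forall>f :: nat \<Rightarrow> real \<Rightarrow> complex.
            (\<forall>k\<in>{1..n}. analytic_trig_poly (d k) (f k)) \<longrightarrow>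
            torus_expect (\<lambda>t. sqrt (\<Sum>k\<in>{1..n}. (cmod (f k t))\<^sup>2))
              \<ge> c * torus_expect (\<lambda>t. sqrt (\<Sum>k\<in>{1..n}. (cmod (cond_exp_star (N k) (f k) t))\<^sup>2))))
       \<and>
       ((\<exists>(a::nat) (C::real). \<forall>k\<ge>1. real (d k) \<le> C * real (N (k + a)))
        \<longleftrightarrow>
         (\<exists>c>0. \<forall>n. \<forall>f :: nat \<Rightarrow> real \<Rightarrow> complex.
            (\<forall>k\<in>{1..n}. analytic_trig_poly (d k) (f k)) \<longrightarrow>
            L1_l2_norm n f \<ge> c * ind_norm n (\<lambda>k. cond_exp_star (N k) (f k))))"
    (is "(?i \<longleftrightarrow> ?ii) \<and> (?i \<longleftrightarrow> ?iii)")
proof -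
  let ?E = "\<lambda>n f. \<integral>t. L2_set (\<lambda>k. cmod (f k t)) {1..n} \<partial>torus"
  let ?T = "\<lambda>n f. \<integral>t. L2_set (\<lambda>k. cmod (cond_exp_star (N k) (f k) t)) {1..n} \<partial>torus"
  let ?P = "\<lambda>n f. \<integral>x. L2_set (\<lambda>k. cmod (cond_exp_star (N k) (f k) (x k))) {1..n} \<partial>PiM {1..n} (\<lambda>_. torus)"
  have ii: "?ii \<longleftrightarrow> (\<exists>c>0. \<forall>n f. (\<forall>k\<in>{1..n}. analytic_trig_poly (d k) (f k)) \<longrightarrow> c * ?T n f \<le> ?E n f)"
    unfolding torus_expect_def L2_set_def ..
  have iii: "?iii \<longleftrightarrow> (\<exists>c>0. \<forall>n f. (\<forall>k\<in>{1..n}. analytic_trig_poly (d k) (f k)) \<longrightarrow> c * ?P n f \<le> ?E n f)"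
    unfolding L1_l2_norm_def ind_norm_def torus_expect_def L2_set_def ..
  have Npos: "N k > 0" if "k \<ge> 1" for k
    using that by (rule dvd_chain_pos[OF Ndvd Nless])
  have Nmono: "N k \<le> N l" if "1 \<le> k" "k \<le> l" for k l
    using dvd_chain_dvd[OF Ndvd that(1), of "l - k"] Npos[of l] that by (auto intro: dvd_imp_le)
  \<comment> \<open>Lacunarity makes \<open>d\<close> nondecreasing, so a degree that is large at
    one index stays large at all later ones.\<close>
  have dmono: "d k \<le> d l" if "1 \<le> k" "k \<le> l" for k l
    using that(2)
  proof (induction rule: dec_induct)
    case base
    then show ?case by simp
  next
    case (step m)
    obtain q where "q > 1" "\<forall>k\<ge>1. q * real (d k) \<le> real (d (Suc k))"
      using lac by (auto simp: lacunary_def)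
    moreover have "m \<ge> 1" using step that by simp
    ultimately have "q * real (d m) \<le> real (d (Suc m))" by blast
    moreover have "1 * real (d m) \<le> q * real (d m)"
      using \<open>q > 1\<close> by (intro mult_right_mono) auto
    ultimately show ?case using step by linarith
  qed
  have forward: "\<exists>c>0. \<forall>n f. (\<forall>k\<in>{1..n}. analytic_trig_poly (d k) (f k)) \<longrightarrow>
      c * ?T n f \<le> ?E n f \<and> c * ?P n f \<le> ?E n f" if ?i
  proof -
    from that obtain a C where aC: "\<And>k. k \<ge> 1 \<Longrightarrow> real (d k) \<le> C * real (N (k + a))"
      by blast
    \<comment> \<open>The step is \<open>Suc a\<close>, which is positive even for
      \<open>a = 0\<close>, and the absolute value supplies a nonnegative constant.\<close>
    define B where "B = real (Suc a) * (5 * \<bar>C\<bar> + 9)"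
    have B: "B > 0" unfolding B_def by (intro mult_pos_pos) auto
    have dN: "real (d k) \<le> \<bar>C\<bar> * real (N l)" if "k \<ge> 1" "k + Suc a \<le> l" for k l
    proof -
      have "real (d k) \<le> C * real (N (k + a))" using aC that by simp
      also have "\<dots> \<le> \<bar>C\<bar> * real (N l)"
        using Nmono[of "k + a" l] that by (intro mult_mono) auto
      finally show ?thesis .
    qed
    have *: "(\<integral>w. L2_set (\<lambda>k. cmod (cond_exp_star (N k) (f k) (X k w))) {1..n} \<partial>W) \<le> B * ?E n f"
      if "torus_coupling W {1..n} X" and f: "\<forall>k\<in>{1..n}. analytic_trig_poly (d k) (f k)"
      for n f and W :: "'w measure" and X
    proof -
      interpret torus_coupling W "{1..n}" X by fact
      show ?thesis
        unfolding B_def cond_exp_star_eq_star_mean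
        by (rule integral_L2_set_star_mean_le_step[where d = d]) (use f Npos dN in auto)
    qed
    have T: "?T n f \<le> B * ?E n f" if "\<forall>k\<in>{1..n}. analytic_trig_poly (d k) (f k)" for n f
      using *[OF torus_coupling_identity that] .
    have P: "?P n f \<le> B * ?E n f" if "\<forall>k\<in>{1..n}. analytic_trig_poly (d k) (f k)" for n f
      using *[OF torus_coupling_product that] .
    show ?thesis
      using B T P by (intro exI[of _ "1 / B"]) (auto simp: divide_le_eq mult.commute)
  qed
  \<comment> \<open>The failure of (i) is used with \<open>a = 8 * b\<close> and
    \<open>C = 4\<close>: the shift is the length of the window, and 4 comes from the degree
    \<open>4 * L\<close> of the peak.\<close>
  have window: "\<exists>k\<ge>1. \<forall>l\<ge>k. 4 * N (k + 8 * b) \<le> d l" if "\<not> ?i" for b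
  proof -
    from that have "\<not> (\<forall>k\<ge>1. real (d k) \<le> 4 * real (N (k + 8 * b)))" by blast
    then obtain k where k: "k \<ge> 1" "real (d k) > 4 * real (N (k + 8 * b))"
      by (auto simp: not_le)
    then have "4 * N (k + 8 * b) \<le> d k" by linarith
    then show ?thesis using k dmono by (meson order_trans)
  qed
  have backward_ii: False if "\<not> ?i" and c: "c > 0"
    and lower: "\<And>n f. (\<forall>k\<in>{1..n}. analytic_trig_poly (d k) (f k)) \<Longrightarrow> c * ?T n f \<le> ?E n f" for c
  proof -
    \<comment> \<open>The window is taken long enough to contradict
      \<open>c * sqrt b \<le> 2\<close>.\<close>
    obtain b :: nat where b: "c * sqrt (real b) > 2" using ex_sqrt_gt[OF c] by blast
    obtain k where k: "k \<ge> 1" "\<And>l. l \<ge> k \<Longrightarrow> 4 * N (k + 8 * b) \<le> d l"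
      using window[OF \<open>\<not> ?i\<close>] by blast
    interpret torus_coupling torus "{1..k + 8 * b}" "\<lambda>k t. t"
      by (rule torus_coupling_identity)
    have "c * sqrt (real b) \<le> 2"
      by (rule lower_constant_le[OF Ndvd Nless k(1) refl _ k(2) _ lower])
         (use c in \<open>auto intro: integral_sqrt_peak_mean_mult_le\<close>)
    with b show False by simp
  qed
  have backward_iii: False if "\<not> ?i" and c: "c > 0"
    and lower: "\<And>n f. (\<forall>k\<in>{1..n}. analytic_trig_poly (d k) (f k)) \<Longrightarrow> c * ?P n f \<le> ?E n f" for c
  proof -
    obtain b :: nat where b: "c * sqrt (real b) > 2" using ex_sqrt_gt[OF c] by blast
    obtain k where k: "k \<ge> 1" "\<And>l. l \<ge> k \<Longrightarrow> 4 * N (k + 8 * b) \<le> d l"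
      using window[OF \<open>\<not> ?i\<close>] by blast
    let ?n = "k + 8 * b"
    interpret torus_coupling "PiM {1..?n} (\<lambda>_. torus)" "{1..?n}" "\<lambda>k x. x k"
      by (rule torus_coupling_product)
    \<comment> \<open>Distinct coordinates are independent, so the mean of the product is the
      product of the means.\<close>
    have pair: "(\<integral>x. sqrt (peak_mean (N ?n) K (x i)) * sqrt (peak_mean (N ?n) M (x j)) \<partial>PiM {1..?n} (\<lambda>_. torus))
        \<le> 2 * sqrt (real K / real M) * real (N ?n) ^ 3"
      if "i \<in> {1..?n}" "j \<in> {1..?n}" "i \<noteq> j" "0 < M" "M \<le> N ?n" for i j K M
    proof -
      have "(\<integral>x. sqrt (peak_mean (N ?n) K (x i)) * sqrt (peak_mean (N ?n) M (x j)) \<partial>PiM {1..?n} (\<lambda>_. torus))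
          = (\<integral>t. sqrt (peak_mean (N ?n) K t) \<partial>torus) * (\<integral>t. sqrt (peak_mean (N ?n) M t) \<partial>torus)"
        using that by (intro integral_PiM_mult_two continuous_intros continuous_on_peak_mean) auto
      then show ?thesis
        using integral_sqrt_peak_mean_prod_le[OF that(4,5)] by simp
    qed
    have "c * sqrt (real b) \<le> 2"
      by (rule lower_constant_le[OF Ndvd Nless k(1) refl _ k(2) pair lower]) (use c in auto)
    with b show False by simp
  qed
  show ?thesis
    unfolding ii iii using forward backward_ii backward_iii by blast
qed

end
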